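(* For $n\geq 3$, we have $\mathrm{Alt}(\bar{\mathcal{X}})\subseteq G$.
   Context: Fix $m\in\mathbb{N}$ and a prime power $q$. Let $\Delta=\mathrm{Gal}(\mathbb{F}_{q^m}:\mathbb{F}_q)$ act coordinatewise on $\mathbb{F}_{q^m}^n$; let $\mathcal{X}$ be the union of the orbits of size exactly $m$, and $\bar{\mathcal{X}}$ the set of these orbits. The tame automorphism group $\mathrm{TA}_n(\mathbb{F}_q)$ (the subgroup of polynomial automorphisms of $\mathbb{F}_q^n$ generated by invertible affine maps and triangular maps $(a_1X_1+f_1,\dots,a_nX_n+f_n)$, $a_i\in\mathbb{F}_q^*$, $f_i\in\mathbb{F}_q[X_{i+1},\dots,X_n]$) acts on $\mathcal{X}$ by evaluation, commuting with $\Delta$, hence acts on $\bar{\mathcal{X}}$. $G$ denotes the image of the resulting homomorphism $\mathrm{TA}_n(\mathbb{F}_q)\to\mathrm{Sym}(\bar{\mathcal{X}})$. *)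

theory Defs
  imports "HOL-Combinatorics.Combinatorics" "HOL-Computational_Algebra.Primes"
begin

text \<open>Setup. The field F_{q^m} is a finite field type 'a with CARD('a) = q^m.
  F_q is its unique subfield of order q, namely the fixed field of the
  Frobenius x \<mapsto> x^q, which generates Gal(F_{q^m} : F_q).
  Points of F_{q^m}^n are functions nat \<Rightarrow> 'a vanishing from index n on;
  coordinates X_1..X_n are indices 0..n-1.\<close>

definition Fq :: "nat \<Rightarrow> 'a::field set" where
  "Fq q = {x. x ^ q = x}"

definition points :: "nat \<Rightarrow> (nat \<Rightarrow> 'a::zero) set" where
  "points n = {x. \<forall>i\<ge>n. x i = 0}"

inductive_set polyfun :: "'a::comm_ring_1 set \<Rightarrow> nat set \<Rightarrow> ((nat \<Rightarrow> 'a) \<Rightarrow> 'a) set"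
  for C V where
  const: "c \<in> C \<Longrightarrow> (\<lambda>x. c) \<in> polyfun C V"
| var: "j \<in> V \<Longrightarrow> (\<lambda>x. x j) \<in> polyfun C V"
| add: "f \<in> polyfun C V \<Longrightarrow> g \<in> polyfun C V \<Longrightarrow> (\<lambda>x. f x + g x) \<in> polyfun C V"
| mult: "f \<in> polyfun C V \<Longrightarrow> g \<in> polyfun C V \<Longrightarrow> (\<lambda>x. f x * g x) \<in> polyfun C V"

definition affine_maps :: "nat \<Rightarrow> nat \<Rightarrow> ((nat \<Rightarrow> 'a::field) \<Rightarrow> (nat \<Rightarrow> 'a)) set" where
  "affine_maps n q = {F. \<exists>A b B.
      (\<forall>i<n. \<forall>j<n. A i j \<in> Fq q \<and> B i j \<in> Fq q) \<and> (\<forall>i<n. b i \<in> Fq q) \<and>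
      (\<forall>i<n. \<forall>k<n. (\<Sum>j<n. A i j * B j k) = (if i = k then 1 else 0)) \<and>
      (\<forall>i<n. \<forall>k<n. (\<Sum>j<n. B i j * A j k) = (if i = k then 1 else 0)) \<and>
      F = (\<lambda>x i. if i < n then (\<Sum>j<n. A i j * x j) + b i else 0)}"

definition triangular_maps :: "nat \<Rightarrow> nat \<Rightarrow> ((nat \<Rightarrow> 'a::field) \<Rightarrow> (nat \<Rightarrow> 'a)) set" where
  "triangular_maps n q = {F. \<exists>a f.
      (\<forall>i<n. a i \<in> Fq q \<and> a i \<noteq> 0 \<and> f i \<in> polyfun (Fq q) {j. i < j \<and> j < n}) \<and>
      F = (\<lambda>x i. if i < n then a i * x i + f i x else 0)}"

text \<open>Tame automorphisms (as evaluation maps on F_{q^m}^n): the group generated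
  by the affine and triangular maps. Both generating sets are closed under
  inverses, so this is the closure under composition (the identity is affine).\<close>
inductive_set tame_maps :: "nat \<Rightarrow> nat \<Rightarrow> ((nat \<Rightarrow> 'a::field) \<Rightarrow> (nat \<Rightarrow> 'a)) set"
  for n q where
  affine: "F \<in> affine_maps n q \<Longrightarrow> F \<in> tame_maps n q"
| triangular: "F \<in> triangular_maps n q \<Longrightarrow> F \<in> tame_maps n q"
| comp: "F \<in> tame_maps n q \<Longrightarrow> H \<in> tame_maps n q \<Longrightarrow> F \<circ> H \<in> tame_maps n q"

definition frob :: "nat \<Rightarrow> (nat \<Rightarrow> 'a::field) \<Rightarrow> (nat \<Rightarrow> 'a)" where
  "frob q x = (\<lambda>i. x i ^ q)"

definition orbit :: "nat \<Rightarrow> nat \<Rightarrow> (nat \<Rightarrow> 'a::field) \<Rightarrow> (nat \<Rightarrow> 'a) set" where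
  "orbit q m x = {(frob q ^^ k) x | k. k < m}"

definition Xset :: "nat \<Rightarrow> nat \<Rightarrow> nat \<Rightarrow> (nat \<Rightarrow> 'a::field) set" where
  "Xset n q m = {x \<in> points n. card (orbit q m x) = m}"

definition Xbar :: "nat \<Rightarrow> nat \<Rightarrow> nat \<Rightarrow> (nat \<Rightarrow> 'a::field) set set" where
  "Xbar n q m = orbit q m ` Xset n q m"

definition induced_perm :: "nat \<Rightarrow> nat \<Rightarrow> nat \<Rightarrow> ((nat \<Rightarrow> 'a::field) \<Rightarrow> (nat \<Rightarrow> 'a))
    \<Rightarrow> (nat \<Rightarrow> 'a) set \<Rightarrow> (nat \<Rightarrow> 'a) set" where
  "induced_perm n q m F Ob = (if Ob \<in> Xbar n q m then F ` Ob else Ob)"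

definition Ggroup :: "nat \<Rightarrow> nat \<Rightarrow> nat \<Rightarrow> ((nat \<Rightarrow> 'a::field) set \<Rightarrow> (nat \<Rightarrow> 'a) set) set" where
  "Ggroup n q m = induced_perm n q m ` tame_maps n q"

definition Alt :: "'b set \<Rightarrow> ('b \<Rightarrow> 'b) set" where
  "Alt S = {\<sigma>. \<sigma> permutes S \<and> evenperm \<sigma>}"

end

theory Submission
  imports Defs "HOL-Computational_Algebra.Polynomial"
begin

text \<open>
  Averaging over the Galois group produces a polynomial over \<open>F_q\<close> that vanishes off the
  orbit of a given point \<open>u\<close> of full period and takes a prescribed value at \<open>u\<close>. The
  corresponding shear moves only the orbits meeting one line parallel to a coordinate axis. If some
  coordinate of \<open>P\<close> generates \<open>F_{q^m}\<close>, two such shears through \<open>P\<close> along two other axes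
  move only the orbit of \<open>P\<close> in common, so that their commutator is a 3-cycle.

  Call two orbits linked if they are equal or some 3-cycle of the group maps one to the other; this
  is an equivalence relation invariant under the group, and if it is total then the group contains
  all even permutations. The 3-cycles above link all points with a generating coordinate,
  and shears preserve this class. Finally, any point of full period is moved into the class by
  successively adding a polynomial in \<open>x_i\<close> to \<open>x_{i+1}\<close> in such a way that the sum
  generates the field generated by \<open>x_i\<close> and \<open>x_{i+1}\<close>.
\<close>

section \<open>Permutation groups containing 3-cycles\<close>

definition cyc3 :: "'b \<Rightarrow> 'b \<Rightarrow> 'b \<Rightarrow> 'b \<Rightarrow> 'b" where
  "cyc3 a b c = transpose a b \<circ> transpose b c"

lemma cyc3_apply:
  assumes "a \<noteq> b" "b \<noteq> c" "a \<noteq> c"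
  shows "cyc3 a b c x = (if x = a then b else if x = b then c else if x = c then a else x)"
  using assms by (auto simp: cyc3_def transpose_def)

lemma cyc3_rotate:
  assumes "a \<noteq> b" "b \<noteq> c" "a \<noteq> c"
  shows "cyc3 b c a = cyc3 a b c"
  using assms by (auto simp: fun_eq_iff cyc3_apply)

lemma comp_cyc3:
  assumes "inj h"
  shows "h \<circ> cyc3 a b c = cyc3 (h a) (h b) (h c) \<circ> h"
  using assms by (auto simp: fun_eq_iff cyc3_def transpose_def inj_def)

lemma cyc3_inverse: "cyc3 c b a \<circ> cyc3 a b c = id"
  by (simp add: cyc3_def fun_eq_iff transpose_commute transpose_involutory)

lemma cyc3_permutes: "a \<in> S \<Longrightarrow> b \<in> S \<Longrightarrow> c \<in> S \<Longrightarrow> cyc3 a b c permutes S"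
  by (simp add: cyc3_def permutes_compose permutes_swap_id)

lemma cyc3_even:
  assumes "a \<noteq> b" "b \<noteq> c"
  shows "evenperm (cyc3 a b c)"
  using assms by (simp add: cyc3_def evenperm_comp evenperm_swap permutation_swap_id)

locale finite_perm_group =
  fixes S :: "'b set" and H :: "('b \<Rightarrow> 'b) set"
  assumes finite_S: "finite S"
    and id_mem: "id \<in> H"
    and comp_mem: "g \<in> H \<Longrightarrow> h \<in> H \<Longrightarrow> g \<circ> h \<in> H"
    and mem_permutes: "h \<in> H \<Longrightarrow> h permutes S"
begin

text \<open>Left composition with \<open>h\<close> is an injective self-map of the finite set
  \<open>H\<close>, hence surjective, and so it hits \<open>id\<close>.\<close>

lemma inv_mem:
  assumes "h \<in> H"
  shows "inv h \<in> H"
proof -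
  have "H \<subseteq> {f. f permutes S}" using mem_permutes by auto
  hence fin: "finite H" using finite_permutations[OF finite_S] finite_subset by blast
  have "inj_on ((\<circ>) h) H"
    using permutes_inj[OF mem_permutes[OF assms]] by (auto simp: inj_on_def fun_eq_iff inj_def)
  moreover have "(\<circ>) h ` H \<subseteq> H" using comp_mem[OF assms] by auto
  ultimately have "(\<circ>) h ` H = H" using endo_inj_surj[OF fin] by blast
  then obtain g where g: "g \<in> H" "h \<circ> g = id" using id_mem by (metis imageE)
  have "inv h = g" using g(2) permutes_inv_o(2)[OF mem_permutes[OF assms]]
    by (metis comp_assoc comp_id id_comp)
  thus ?thesis using g by simp
qed

lemma conj_cyc3_mem:
  assumes "cyc3 a b c \<in> H" "h \<in> H"
  shows "cyc3 (h a) (h b) (h c) \<in> H"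
proof -
  have "h \<circ> cyc3 a b c \<circ> inv h = cyc3 (h a) (h b) (h c) \<circ> (h \<circ> inv h)"
    using comp_cyc3[of h a b c] permutes_inj[OF mem_permutes[OF assms(2)]] by (simp add: comp_assoc)
  also have "\<dots> = cyc3 (h a) (h b) (h c)"
    using permutes_inv_o(1)[OF mem_permutes[OF assms(2)]] by simp
  finally show ?thesis using assms comp_mem inv_mem by metis
qed

lemma cyc3_reverse_mem:
  assumes "cyc3 a b c \<in> H"
  shows "cyc3 c b a \<in> H"
proof -
  have "inv (cyc3 a b c) = cyc3 c b a"
    using cyc3_inverse[of c b a] cyc3_inverse[of a b c] by (metis inv_unique_comp)
  thus ?thesis using inv_mem[OF assms] by simp
qed

definition linked :: "'b \<Rightarrow> 'b \<Rightarrow> bool" where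
  "linked a b \<longleftrightarrow> a = b \<or> (\<exists>c. a \<noteq> b \<and> b \<noteq> c \<and> a \<noteq> c \<and> cyc3 a b c \<in> H)"

lemma linked_refl: "linked a a"
  by (simp add: linked_def)

lemma linked_sym: "linked a b \<Longrightarrow> linked b a"

proof -
  assume "linked a b"
  thus ?thesis
    unfolding linked_def
  proof (elim disjE exE conjE)
    fix c assume "a \<noteq> b" "b \<noteq> c" "a \<noteq> c" "cyc3 a b c \<in> H"
    thus "b = a \<or> (\<exists>c. b \<noteq> a \<and> a \<noteq> c \<and> b \<noteq> c \<and> cyc3 b a c \<in> H)"
      using cyc3_reverse_mem[of a b c] cyc3_rotate[of c b a] by (intro disjI2 exI[of _ c]) auto
  qed simp
qed

lemma linked_image:
  assumes "linked a b" "h \<in> H"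
  shows "linked (h a) (h b)"
proof -
  have "inj h" using permutes_inj[OF mem_permutes[OF assms(2)]] .
  thus ?thesis
    using assms(1) conj_cyc3_mem[OF _ assms(2), of a b] unfolding linked_def by (metis inj_eq)
qed

lemma linked_image_iff:
  assumes "h \<in> H"
  shows "linked (h a) (h b) \<longleftrightarrow> linked a b"
  using linked_image[OF _ assms] linked_image[OF _ inv_mem[OF assms], of "h a" "h b"]
    permutes_inverses(2)[OF mem_permutes[OF assms]] by metis

text \<open>Conjugating the link of \<open>a\<close> and \<open>b\<close> by
  \<open>cyc3 b d e\<close> gives a link of \<open>a\<close> and \<open>d\<close>, provided that
  this cycle fixes \<open>a\<close>. If \<open>e = a\<close>, the cycle itself links
  \<open>d\<close> and \<open>a\<close>.\<close>

lemma linked_trans: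
  assumes "linked a b" "linked b d"
  shows "linked a d"
proof (cases "a = b \<or> b = d \<or> a = d")
  case True
  thus ?thesis using assms linked_refl by auto
next
  case False
  then obtain c e where c: "b \<noteq> c" "a \<noteq> c" "cyc3 a b c \<in> H"
    and e: "d \<noteq> e" "b \<noteq> e" "cyc3 b d e \<in> H"
    using assms unfolding linked_def by auto
  show ?thesis
  proof (cases "e = a")
    case True
    hence "cyc3 d a b \<in> H" using cyc3_rotate[of b d a] e False by auto
    hence "linked d a" unfolding linked_def using False e by auto
    thus ?thesis by (rule linked_sym)
  next
    case ne: False
    have "linked a b" using assms by simp
    hence "linked (cyc3 b d e a) (cyc3 b d e b)" using linked_image e(3) by blast
    thus ?thesis using False e ne by (auto simp: cyc3_apply)
  qed
qed

text \<open>If \<open>s\<close> moves \<open>x\<close>, it also moves \<open>s x\<close>, and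
  likewise for \<open>t\<close>. As only \<open>P\<close> is moved by both, they commute at every
  \<open>x\<close> such that none of \<open>x\<close>, \<open>s x\<close>, \<open>t x\<close> is
  \<open>P\<close>; the remaining points form the 3-cycle.\<close>

lemma commutator_cyc3:
  assumes "s \<in> H" "t \<in> H" "s P \<noteq> P" "t P \<noteq> P"
    and common: "\<And>x. s x \<noteq> x \<Longrightarrow> t x \<noteq> x \<Longrightarrow> x = P"
  shows "s P \<noteq> t P" and "cyc3 P (s P) (t P) \<in> H"
proof -
  have injs: "inj s" and injt: "inj t" using permutes_inj mem_permutes assms(1,2) by blast+
  have s1: "s x \<noteq> x \<Longrightarrow> x \<noteq> P \<Longrightarrow> t x = x" and t1: "t x \<noteq> x \<Longrightarrow> x \<noteq> P \<Longrightarrow> s x = x" for x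
    using common by blast+
  have tA: "t (s P) = s P" using s1[of "s P"] injs assms(3) by (metis injD)
  have sB: "s (t P) = t P" using t1[of "t P"] injt assms(4) by (metis injD)
  have tt: "t (t P) \<noteq> t P" using injt assms(4) by (metis injD)
  show ne: "s P \<noteq> t P" using tA tt by metis
  have cyc: "cyc3 P (s P) (t P) x = (if x = P then s P else if x = s P then t P else if x = t P then P else x)" for x
    using assms(3,4) ne by (intro cyc3_apply) auto
  have "s (t x) = cyc3 P (s P) (t P) (t (s x))" for x
  proof -
    consider "x = P" | "x \<noteq> P" "t x = P" | "x \<noteq> P" "s x = P" | "x \<noteq> P" "t x \<noteq> P" "s x \<noteq> P" by blast
    thus ?thesis
    proof cases
      case 1
      thus ?thesis using sB tA assms(3) by (simp add: cyc)
    next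
      case 2
      hence "s x = x" using t1[of x] by metis
      thus ?thesis using 2 by (simp add: cyc)
    next
      case 3
      hence "t x = x" using s1[of x] by metis
      thus ?thesis using 3 ne assms(3,4) by (simp add: cyc)
    next
      case 4
      \<comment> \<open>Here \<open>s\<close> and \<open>t\<close> commute at \<open>x\<close>, and
        the common value is none of the three points of the cycle.\<close>
      have eq: "s (t x) = t (s x)"
      proof (cases "t x = x")
        case True
        show ?thesis
        proof (cases "s x = x")
          case False
          hence "s (s x) \<noteq> s x" using injs by (metis injD)
          thus ?thesis using s1[of "s x"] 4 True by simp
        qed (simp add: True)
      next
        case False
        hence "s x = x" using t1 4 by simp
        moreover have "t (t x) \<noteq> t x" using False injt by (metis injD)
        ultimately show ?thesis using t1[of "t x"] 4 by simp
      qed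
      moreover have "s (t x) \<noteq> P"
      proof
        assume a: "s (t x) = P"
        hence "s (t x) \<noteq> t x" using 4 by simp
        hence "t (t x) = t x" using s1 4 by metis
        hence "t x = x" using injt by (metis injD)
        thus False using a 4 by simp
      qed
      moreover have "s (t x) \<noteq> s P" using injs 4 by (metis injD)
      moreover have "t (s x) \<noteq> t P" using injt 4 by (metis injD)
      ultimately show ?thesis by (simp add: cyc)
    qed
  qed
  hence eq: "s \<circ> t = cyc3 P (s P) (t P) \<circ> (t \<circ> s)" by (simp add: fun_eq_iff)
  have ts: "t \<circ> s \<in> H" using comp_mem assms(1,2) by blast
  have "s \<circ> t \<circ> inv (t \<circ> s) = cyc3 P (s P) (t P)"
    unfolding eq comp_assoc[of "cyc3 P (s P) (t P)" "t \<circ> s"] permutes_inv_o(1)[OF mem_permutes[OF ts]] by simp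
  thus "cyc3 P (s P) (t P) \<in> H" using comp_mem inv_mem[OF ts] assms(1,2) by metis
qed

text \<open>The third point \<open>c\<close> of a 3-cycle linking \<open>a\<close> and
  \<open>b\<close> is not under control. A cycle \<open>cyc3 c d e\<close> linking \<open>c\<close>
  and \<open>d\<close> conjugates it to the desired one unless \<open>e\<close> is \<open>a\<close>
  or \<open>b\<close>; in these cases all points lie in \<open>{a, b, c, d}\<close> and a few more
  conjugations and inverses suffice.\<close>

lemma cyc3_mem_if_linked:
  assumes linked: "\<And>a b. a \<in> S \<Longrightarrow> b \<in> S \<Longrightarrow> linked a b"
    and abd: "a \<in> S" "b \<in> S" "d \<in> S" "a \<noteq> b" "b \<noteq> d" "a \<noteq> d"
  shows "cyc3 a b d \<in> H"
proof -
  obtain c where c: "b \<noteq> c" "a \<noteq> c" "cyc3 a b c \<in> H"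
    using linked[of a b] abd unfolding linked_def by auto
  \<comment> \<open>The cycle moves \<open>c\<close>, and elements of \<open>H\<close> move only
    points of \<open>S\<close>.\<close>
  have "cyc3 a b c c = a" using c abd by (auto simp: cyc3_apply)
  hence "c \<in> S" using permutes_not_in[OF mem_permutes[OF c(3)], of c] c by metis
  show ?thesis
  proof (cases "c = d")
    case True thus ?thesis using c by simp
  next
    case False
    then obtain e where e: "d \<noteq> e" "c \<noteq> e" "cyc3 c d e \<in> H"
      using linked[of c d] abd \<open>c \<in> S\<close> unfolding linked_def by auto
    have rev: "cyc3 c b a \<in> H" by (rule cyc3_reverse_mem[OF c(3)])
    consider "e \<noteq> a" "e \<noteq> b" | "e = a" | "e = b" by blast
    thus ?thesis
    proof cases
      case 1
      show ?thesis using conj_cyc3_mem[OF c(3) e(3)] 1 e c abd False by (simp add: cyc3_apply)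
    next
      case 2
      have "cyc3 d c a \<in> H"
        using cyc3_reverse_mem[OF e(3)] 2 cyc3_rotate[of a d c] abd c e by metis
      hence "cyc3 d b c \<in> H"
        using conj_cyc3_mem[OF _ rev, of d c a] abd c False by (auto simp: cyc3_apply)
      hence "cyc3 d a b \<in> H"
        using conj_cyc3_mem[OF _ rev, of d b c] abd c False by (auto simp: cyc3_apply)
      thus ?thesis using cyc3_rotate[of d a b] abd by metis
    next
      case 3
      hence "cyc3 a c d \<in> H"
        using conj_cyc3_mem[OF c(3) e(3)] abd c False by (auto simp: cyc3_apply)
      hence "cyc3 b a d \<in> H"
        using conj_cyc3_mem[OF _ c(3), of a c d] abd c False by (auto simp: cyc3_apply)
      hence "cyc3 d a b \<in> H" by (rule cyc3_reverse_mem)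
      thus ?thesis using cyc3_rotate[of d a b] abd by metis
    qed
  qed
qed

text \<open>Induction on the number of moved points: composing with a suitable 3-cycle fixes one
  further point and moves no new one.\<close>

lemma even_permutation_mem:
  assumes cyc: "\<And>a b c. a \<in> S \<Longrightarrow> b \<in> S \<Longrightarrow> c \<in> S \<Longrightarrow> a \<noteq> b \<Longrightarrow> b \<noteq> c \<Longrightarrow> a \<noteq> c \<Longrightarrow> cyc3 a b c \<in> H"
    and "\<sigma> permutes S" "evenperm \<sigma>"
  shows "\<sigma> \<in> H"
  using assms(2,3)
proof (induction "card {x. \<sigma> x \<noteq> x}" arbitrary: \<sigma> rule: less_induct)
  case less
  have sub: "{x. \<sigma> x \<noteq> x} \<subseteq> S" using less.prems permutes_not_in by fastforce
  have inj: "inj \<sigma>" using permutes_inj[OF less.prems(1)] .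
  show ?case
  proof (cases "\<exists>a. \<sigma> a \<noteq> a")
    case False
    hence "\<sigma> = id" by auto
    thus ?thesis using id_mem by simp
  next
    case True
    then obtain a where a: "\<sigma> a \<noteq> a" by auto
    define b where "b = \<sigma> a"
    have ab: "a \<noteq> b" and b: "\<sigma> b \<noteq> b" using a inj unfolding b_def inj_def by metis+
    \<comment> \<open>Otherwise the even permutation \<open>\<sigma>\<close> would be the
      transposition of \<open>a\<close> and \<open>b\<close>.\<close>
    have "\<exists>c. \<sigma> c \<noteq> c \<and> c \<noteq> a \<and> c \<noteq> b"
    proof (rule ccontr)
      assume "\<not> ?thesis"
      hence fixd: "\<sigma> c = c" if "c \<noteq> a" "c \<noteq> b" for c using that by auto
      have "\<sigma> b = a"
      proof (rule ccontr)
        assume "\<sigma> b \<noteq> a"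
        hence "\<sigma> (\<sigma> b) = \<sigma> b" using fixd b by simp
        thus False using b inj by (auto simp: inj_def)
      qed
      hence "\<sigma> = transpose a b" using fixd by (auto simp: fun_eq_iff transpose_def b_def)
      thus False using less.prems(2) ab by (simp add: evenperm_swap)
    qed
    then obtain c where c: "\<sigma> c \<noteq> c" "c \<noteq> a" "c \<noteq> b" by auto
    define \<tau> where "\<tau> = cyc3 c b a \<circ> \<sigma>"
    have abc: "a \<in> S" "b \<in> S" "c \<in> S" using a b c sub by auto
    have perm: "\<tau> permutes S"
      unfolding \<tau>_def using less.prems(1) abc by (intro permutes_compose cyc3_permutes)
    have "permutation (cyc3 c b a)" "permutation \<sigma>"
      using cyc3_permutes[OF abc(3,2,1)] less.prems(1) finite_S permutation_permutes by blast+
    hence even: "evenperm \<tau>"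
      unfolding \<tau>_def using less.prems(2) ab c(3) cyc3_even[of c b a] by (simp add: evenperm_comp)
    have ap: "cyc3 c b a x = (if x = c then b else if x = b then a else if x = a then c else x)" for x
      using ab c by (intro cyc3_apply) auto
    have "\<tau> a = a" using ab c by (simp add: \<tau>_def ap b_def[symmetric])
    moreover have "\<tau> x = x" if "\<sigma> x = x" for x
      using that a b c by (auto simp: \<tau>_def ap)
    ultimately have "{x. \<tau> x \<noteq> x} \<subset> {x. \<sigma> x \<noteq> x}" using a by auto
    hence "card {x. \<tau> x \<noteq> x} < card {x. \<sigma> x \<noteq> x}"
      using finite_subset[OF sub finite_S] psubset_card_mono by blast
    hence "\<tau> \<in> H" using less.hyps perm even by blast
    moreover have "\<sigma> = cyc3 a b c \<circ> \<tau>"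
      using cyc3_inverse[of a b c] by (simp add: \<tau>_def comp_assoc[symmetric])
    ultimately show ?thesis using comp_mem cyc abc ab c by metis
  qed
qed

lemma Alt_subset_if_linked:
  assumes "\<And>a b. a \<in> S \<Longrightarrow> b \<in> S \<Longrightarrow> linked a b"
  shows "Alt S \<subseteq> H"
  unfolding Alt_def using even_permutation_mem cyc3_mem_if_linked[OF assms] by blast

end

section \<open>Polynomial functions over the subfield\<close>

lemma polyfun_uminus:
  assumes "f \<in> polyfun UNIV V"
  shows "(\<lambda>x. - f x) \<in> polyfun UNIV V"
  using polyfun.mult[OF polyfun.const[of "- 1" UNIV V] assms] by simp

lemma polyfun_power:
  assumes "f \<in> polyfun UNIV V"
  shows "(\<lambda>x. f x ^ e) \<in> polyfun UNIV V"
  by (induction e) (auto intro: polyfun.intros assms)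

lemma polyfun_prod:
  assumes "finite A" "\<And>j. j \<in> A \<Longrightarrow> f j \<in> polyfun UNIV V"
  shows "(\<lambda>x. \<Prod>j\<in>A. f j x) \<in> polyfun UNIV V"
  using assms by (induction A rule: finite_induct) (auto intro: polyfun.intros)

lemma polyfun_cong:
  assumes "f \<in> polyfun C V" "\<And>j. j \<in> V \<Longrightarrow> x j = y j"
  shows "f x = f y"
  using assms by (induction rule: polyfun.induct) auto

lemma polyfun_mono:
  assumes "f \<in> polyfun C V" "V \<subseteq> W"
  shows "f \<in> polyfun C W"
  using assms by (induction rule: polyfun.induct) (auto intro: polyfun.intros)

text \<open>The linear span, over the large field, of the polynomial functions with coefficients in
  F_q. In this form a Galois average can be computed term by term.\<close>

inductive_set polyspan :: "nat \<Rightarrow> nat set \<Rightarrow> ((nat \<Rightarrow> 'a::field) \<Rightarrow> 'a) set" for q V where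
  scale: "h \<in> polyfun (Fq q) V \<Longrightarrow> (\<lambda>x. c * h x) \<in> polyspan q V"
| add: "f \<in> polyspan q V \<Longrightarrow> g \<in> polyspan q V \<Longrightarrow> (\<lambda>x. f x + g x) \<in> polyspan q V"

lemma polyspan_mult:
  assumes "f \<in> polyspan q V" "g \<in> polyspan q V"
  shows "(\<lambda>x. f x * g x) \<in> polyspan q V"
  using assms(1)
proof (induction rule: polyspan.induct)
  case (scale h c)
  show ?case using assms(2)
  proof (induction rule: polyspan.induct)
    case (scale h' d)
    have "(\<lambda>x. (c * d) * (h x * h' x)) \<in> polyspan q V"
      using \<open>h \<in> _\<close> scale by (intro polyspan.scale polyfun.mult)
    thus ?case by (simp add: mult_ac)
  next
    case (add f g)
    thus ?case using polyspan.add[OF add.IH] by (simp add: distrib_left)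
  qed
next
  case (add f1 f2)
  thus ?case using polyspan.add[OF add.IH] by (simp add: distrib_right)
qed

lemma polyfun_UNIV_subset_polyspan:
  assumes "f \<in> polyfun UNIV V" "q > 0"
  shows "f \<in> polyspan q V"
  using assms(1)
proof (induction rule: polyfun.induct)
  case (const c)
  have "(\<lambda>x. c * 1) \<in> polyspan q V"
    by (intro polyspan.scale polyfun.const) (simp add: Fq_def)
  thus ?case by simp
next
  case (var j)
  show ?case using polyspan.scale[OF polyfun.var[OF var], where c = 1] by simp
qed (auto intro: polyspan.add polyspan_mult)

section \<open>Frobenius powers in a finite field\<close>

locale finite_field_ext =
  fixes q m p k :: nat and ty :: "'a::{finite,field} itself"
  assumes p: "prime p" and k1: "k \<ge> 1" and q: "q = p ^ k" and m1: "m \<ge> 1"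
    and card_UNIV: "card (UNIV :: 'a set) = q ^ m"
begin

lemma q_ge_2: "q \<ge> 2"
  using prime_ge_2_nat[OF p] self_le_power[of p k] k1 by (simp add: q)

lemma power_card_minus_1:
  assumes "(x::'a) \<noteq> 0"
  shows "x ^ (q ^ m - 1) = 1"
proof -
  define U where "U = UNIV - {0::'a}"
  have "bij_betw ((*) x) U U"
    unfolding U_def by (rule bij_betwI[of _ _ _ "\<lambda>y. y / x"]) (use assms in auto)
  hence "\<Prod>U = (\<Prod>y\<in>U. x * y)" using prod.reindex_bij_betw[of "(*) x" U U "\<lambda>y. y"] by simp
  also have "\<dots> = x ^ card U * \<Prod>U" by (simp add: prod.distrib)
  finally have "x ^ card U * \<Prod>U = 1 * \<Prod>U" by simp
  moreover have "\<Prod>U \<noteq> 0" by (simp add: U_def)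
  ultimately have "x ^ card U = 1" by (metis mult_right_cancel)
  moreover have "card U = q ^ m - 1" by (simp add: U_def card_Diff_subset card_UNIV)
  ultimately show ?thesis by simp
qed

lemma power_card [simp]: "(x::'a) ^ (q ^ m) = x"
proof (cases "x = 0")
  case True
  thus ?thesis using q_ge_2 by (simp add: power_0_left)
next
  case False
  have "q ^ m > 0" using q_ge_2 by simp
  hence "x ^ (q ^ m) = x ^ (q ^ m - 1) * x" by (rule power_minus_mult[symmetric])
  thus ?thesis using power_card_minus_1[OF False] by simp
qed

text \<open>Translation by 1 leaves the sum of all field elements unchanged, so the order of the
  field vanishes in it; that order is a power of \<open>p\<close>.\<close>

lemma CHAR_eq: "CHAR('a) = p"
proof -
  have pr: "prime CHAR('a)" using prime_CHAR_semidom finite_imp_CHAR_pos[where ?'a='a] by auto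
  have "(\<Sum>x\<in>UNIV. x + 1) = (\<Sum>x\<in>(UNIV::'a set). x)"
    by (rule sum.reindex_bij_witness[of _ "\<lambda>x. x - 1" "\<lambda>x. x + 1"]) auto
  hence "of_nat (card (UNIV :: 'a set)) = (0 :: 'a)"
    by (simp add: sum.distrib)
  hence "CHAR('a) dvd p ^ (k * m)"
    by (simp add: card_UNIV q power_mult of_nat_eq_0_iff_char_dvd del: of_nat_power)
  hence "CHAR('a) dvd p" using pr by (rule prime_dvd_power[rotated])
  thus ?thesis using p pr by (simp add: primes_dvd_imp_eq)
qed

lemma add_power: "((x::'a) + y) ^ (q ^ j) = x ^ (q ^ j) + y ^ (q ^ j)"
  by (rule freshmans_dream'[of _ "k * j"]) (simp_all add: CHAR_eq p q power_mult)

lemma sum_power: "(sum f A :: 'a) ^ (q ^ j) = (\<Sum>i\<in>A. f i ^ (q ^ j))"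
  by (rule freshmans_dream_sum'[of _ "k * j"]) (simp_all add: CHAR_eq p q power_mult)

lemma diff_power: "((x::'a) - y) ^ (q ^ j) = x ^ (q ^ j) - y ^ (q ^ j)"
  using add_power[of "x - y" y j] by (simp add: algebra_simps)

lemma power_inj: "(x::'a) ^ (q ^ j) = y ^ (q ^ j) \<longleftrightarrow> x = y"
proof
  assume "x ^ (q ^ j) = y ^ (q ^ j)"
  hence "(x - y) ^ (q ^ j) = 0" by (simp add: diff_power)
  thus "x = y" by simp
qed simp

lemma power_power: "((x::'a) ^ (q ^ i)) ^ (q ^ j) = x ^ (q ^ (i + j))"
  by (simp add: power_mult power_add)

text \<open>The number \<open>a\<close> is the degree of F_q(x) over F_q, found as the least return
  time of \<open>x\<close> under the Frobenius map. Membership in subfields thus becomes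
  divisibility of exponents.\<close>

lemma period_exists:
  fixes x :: 'a
  obtains a where "a > 0" "\<And>j. x ^ (q ^ j) = x \<longleftrightarrow> a dvd j"
proof -
  define a where "a = (LEAST a. a > 0 \<and> x ^ (q ^ a) = x)"
  have a: "a > 0 \<and> x ^ (q ^ a) = x"
    unfolding a_def by (rule LeastI[of _ m]) (use m1 in auto)
  have mult: "x ^ (q ^ (a * i)) = x" for i
  proof (induction i)
    case (Suc i)
    have "x ^ (q ^ (a + a * i)) = x" using a Suc.IH by (simp only: power_power[symmetric])
    thus ?case by simp
  qed simp
  have "x ^ (q ^ j) = x \<longleftrightarrow> a dvd j" for j
  proof
    assume "x ^ (q ^ j) = x"
    hence "x ^ (q ^ (a * (j div a) + j mod a)) = x" by simp
    hence "x ^ (q ^ (j mod a)) = x" by (simp only: power_power[symmetric] mult)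
    moreover have "j mod a < a" using a by simp
    ultimately have "\<not> j mod a > 0"
      using not_less_Least[of "j mod a" "\<lambda>a. a > 0 \<and> x ^ (q ^ a) = x", folded a_def] by auto
    thus "a dvd j" by auto
  qed (use mult in \<open>auto elim!: dvdE\<close>)
  with that a show thesis by blast
qed

text \<open>The fixed elements are the roots of X^(q^g) - X, a nonzero polynomial because the two
  exponents differ.\<close>

lemma card_fixed_le:
  assumes "g > 0"
  shows "card {x::'a. x ^ (q ^ g) = x} \<le> q ^ g"
proof -
  define P :: "'a poly" where "P = monom 1 (q ^ g) - monom 1 1"
  have "q ^ g > 1" using q_ge_2 assms by (intro one_less_power) auto
  hence "coeff P (q ^ g) = 1" by (simp add: P_def)
  hence "P \<noteq> 0" by auto
  have "degree P \<le> q ^ g"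
    unfolding P_def using \<open>q ^ g > 1\<close> by (intro degree_diff_le) (auto simp: degree_monom_eq)
  moreover have "{x. poly P x = 0} = {x::'a. x ^ (q ^ g) = x}"
    by (auto simp: P_def poly_monom)
  ultimately show ?thesis using card_poly_roots_bound[OF \<open>P \<noteq> 0\<close>] by simp
qed

section \<open>Relative traces and primitive elements\<close>

text \<open>For \<open>m = a * b\<close> this is the trace from F_{q^m} to its subfield of order
  \<open>q ^ a\<close>.\<close>

definition rel_trace :: "nat \<Rightarrow> nat \<Rightarrow> 'a \<Rightarrow> 'a" where
  "rel_trace a b v = (\<Sum>i<b. v ^ (q ^ (a * i)))"

text \<open>Raising to the power \<open>q ^ a\<close> shifts the summands cyclically, since
  \<open>v ^ (q ^ m) = v\<close>.\<close>

lemma rel_trace_fixed: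
  assumes "m = a * b"
  shows "rel_trace a b v ^ (q ^ a) = rel_trace a b v"
proof -
  have "rel_trace a b v ^ (q ^ a) = (\<Sum>i<b. v ^ (q ^ (a * Suc i)))"
    by (simp add: rel_trace_def sum_power power_power add.commute del: power_mult)
  moreover have "(\<Sum>i<b. v ^ (q ^ (a * Suc i))) + v = rel_trace a b v + v ^ (q ^ (a * b))"
    using sum.lessThan_Suc_shift[of "\<lambda>i. v ^ (q ^ (a * i))" b] by (simp add: rel_trace_def)
  ultimately show ?thesis using power_card[of v, unfolded assms] by simp
qed

text \<open>Each fibre consists of roots of a polynomial of degree \<open>q ^ (a * (b - 1))\<close>,
  so covering all \<open>q ^ (a * b)\<close> elements takes at least \<open>q ^ a\<close>
  values.\<close>

lemma card_range_rel_trace: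
  assumes ab: "m = a * b"
  shows "q ^ a \<le> card (range (rel_trace a b))"
proof -
  have a0: "a > 0" and b0: "b > 0" using ab m1 by (auto intro!: Nat.gr0I)
  define D where "D = q ^ (a * (b - 1))"
  have D0: "D > 0" using q_ge_2 by (simp add: D_def)
  have fib: "card {v. rel_trace a b v = c} \<le> D" for c
  proof -
    define P :: "'a poly" where "P = (\<Sum>i<b. monom 1 (q ^ (a * i))) - monom c 0"
    \<comment> \<open>The exponents \<open>q ^ (a * i)\<close> are distinct, so only
      \<open>i = b - 1\<close> contributes in degree \<open>D\<close>; the constant \<open>c\<close>
      does not, as \<open>D > 0\<close>.\<close>
    have "q ^ (a * i) = D \<longleftrightarrow> i = b - 1" for i
      using q_ge_2 a0 by (simp add: power_inject_exp D_def)
    hence "coeff P D = (\<Sum>i<b. if i = b - 1 then 1 else 0)"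
      using D0 by (simp add: P_def coeff_sum)
    also have "\<dots> = 1" using b0 by (simp add: sum.delta)
    finally have "P \<noteq> 0" by auto
    have "degree P \<le> D"
      unfolding P_def
    proof (intro degree_diff_le degree_sum_le)
      fix i assume "i \<in> {..<b}"
      hence "q ^ (a * i) \<le> D" unfolding D_def using q_ge_2 by (intro power_increasing) auto
      thus "degree (monom (1::'a) (q ^ (a * i))) \<le> D" by (simp add: degree_monom_eq)
    qed (auto simp: degree_monom_eq monom_0)
    moreover have "{v. poly P v = 0} = {v. rel_trace a b v = c}"
      by (auto simp: P_def poly_monom poly_sum rel_trace_def)
    ultimately show ?thesis using card_poly_roots_bound[OF \<open>P \<noteq> 0\<close>] by simp
  qed
  have "(\<Union>c\<in>range (rel_trace a b). {v. rel_trace a b v = c}) = UNIV" by auto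
  hence "q ^ (a * b) = card (\<Union>c\<in>range (rel_trace a b). {v. rel_trace a b v = c})"
    using card_UNIV ab by simp
  also have "\<dots> \<le> (\<Sum>c\<in>range (rel_trace a b). card {v. rel_trace a b v = c})"
    by (rule card_UN_le) simp
  also have "\<dots> \<le> card (range (rel_trace a b)) * D"
    using sum_bounded_above[of "range (rel_trace a b)" "\<lambda>c. card {v. rel_trace a b v = c}" D] fib by simp
  finally have "q ^ (a * b) \<le> card (range (rel_trace a b)) * D" .
  moreover have "q ^ (a * b) = q ^ a * D" using b0 by (cases b) (simp_all add: D_def power_add)
  ultimately show ?thesis using D0 by simp
qed

text \<open>In \<open>primitive_translate\<close> this bounds the number of bad translations, a sum
  of powers of \<open>q\<close> with distinct exponents below \<open>a\<close>.\<close>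

lemma sum_powers_less: "(\<Sum>e<a. q ^ e) < q ^ a"
proof (induction a)
  case (Suc a)
  have "(\<Sum>e<Suc a. q ^ e) < 2 * q ^ a" using Suc by simp
  also have "\<dots> \<le> q ^ Suc a" using q_ge_2 by simp
  finally show ?case .
qed simp

text \<open>A relative primitive element: the values of the relative trace onto the fixed field of
  \<open>x\<close> outnumber those \<open>v\<close> for which \<open>y + v\<close> lies in a maximal proper
  subfield of the field generated by \<open>x\<close> and \<open>y\<close>.\<close>

lemma primitive_translate:
  fixes x y :: 'a
  assumes ab: "m = a * b" and a: "\<And>j. x ^ (q ^ j) = x \<longleftrightarrow> a dvd j"
  obtains v where "\<And>j. (y + rel_trace a b v) ^ (q ^ j) = y + rel_trace a b v \<Longrightarrow>
      x ^ (q ^ j) = x \<and> y ^ (q ^ j) = y"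
proof -
  have a0: "a > 0" using ab m1 by (auto intro!: Nat.gr0I)
  obtain c where c: "c > 0" "\<And>j. y ^ (q ^ j) = y \<longleftrightarrow> c dvd j" using period_exists by blast
  \<comment> \<open>The degree over F_q of the field generated by \<open>x\<close> and
    \<open>y\<close>.\<close>
  define d where "d = lcm a c"
  have d0: "d > 0" using a0 c by (simp add: d_def lcm_pos_nat)
  define R where "R = range (rel_trace a b)"
  \<comment> \<open>For a prime \<open>l\<close> dividing \<open>d\<close>, these are the traces
    \<open>v\<close> for which \<open>y + v\<close> lies in the maximal proper subfield of degree
    \<open>d div l\<close>.\<close>
  define W where "W l = {v \<in> R. (y + v) ^ (q ^ (d div l)) = y + v}" for l
  define Ls where "Ls = {l. prime l \<and> l dvd a}"
  have finLs: "finite Ls" unfolding Ls_def using a0 by (auto intro: finite_subset[OF _ finite_divisors_nat[of a]])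
  have R_fixed: "v ^ (q ^ a) = v" if "v \<in> R" for v
    using that rel_trace_fixed[OF ab] by (auto simp: R_def)
  have R_fixed_d: "v ^ (q ^ d) = v" if "v \<in> R" for v
  proof -
    obtain e where "e > 0" "\<And>j. v ^ (q ^ j) = v \<longleftrightarrow> e dvd j" using period_exists by blast
    thus ?thesis using R_fixed[OF that] by (auto simp: d_def intro: dvd_trans)
  qed
  \<comment> \<open>A nonempty \<open>W l\<close> lies in a coset of the intersection of the fields
    of degrees \<open>a\<close> and \<open>d div l\<close>.\<close>
  have W: "l dvd a \<and> card (W l) \<le> q ^ (a div l)" if l: "prime l" "l dvd d" "W l \<noteq> {}" for l
  proof -
    obtain s where s: "d = l * s" using l by auto
    have l0: "l > 0" using l prime_gt_0_nat by auto
    have ds: "d div l = s" using s l0 by simp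
    \<comment> \<open>Otherwise \<open>v\<close>, and with it \<open>y\<close>, would lie in the
      field of degree \<open>s\<close>, which contains \<open>x\<close>; then \<open>d\<close> would
      divide \<open>s\<close>.\<close>
    have as: "\<not> a dvd s"
    proof
      assume as: "a dvd s"
      obtain v where v: "v \<in> R" "(y + v) ^ (q ^ s) = y + v" using l(3) unfolding W_def ds by auto
      obtain e where e: "e > 0" "\<And>j. v ^ (q ^ j) = v \<longleftrightarrow> e dvd j" using period_exists by blast
      hence "v ^ (q ^ s) = v" using R_fixed[OF v(1)] as dvd_trans by blast
      hence "y ^ (q ^ s) = y" using v(2) by (simp add: add_power)
      hence "d dvd s" using c as by (simp add: d_def)
      hence "d \<le> s" using s d0 by (intro dvd_imp_le) auto
      thus False using s d0 prime_gt_1_nat[OF l(1)] by auto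
    qed
    \<comment> \<open>An element of both fields has a degree \<open>e\<close> with
      \<open>a = e * r\<close> and \<open>s = e * t\<close>. As \<open>a\<close> divides
      \<open>l * s\<close> but not \<open>s\<close>, the prime \<open>l\<close> divides
      \<open>r\<close>.\<close>
    have key: "l dvd a \<and> w ^ (q ^ (a div l)) = w" if w: "w ^ (q ^ a) = w" "w ^ (q ^ s) = w" for w :: 'a
    proof -
      obtain e where e: "e > 0" "\<And>j. w ^ (q ^ j) = w \<longleftrightarrow> e dvd j" using period_exists by blast
      obtain r t where r: "a = e * r" and t: "s = e * t" using w e by (auto elim!: dvdE)
      have "l dvd r"
      proof (rule ccontr)
        assume "\<not> l dvd r"
        hence "coprime r l" using l(1) by (simp add: prime_imp_coprime coprime_commute)
        moreover have "a dvd d" by (simp add: d_def)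
        hence "e * r dvd e * (l * t)" unfolding s r t by (simp add: mult_ac)
        hence "r dvd l * t" using e(1) by simp
        ultimately have "r dvd t" by (simp add: coprime_dvd_mult_right_iff)
        thus False using as r t by simp
      qed
      then obtain r' where "r = l * r'" by auto
      thus ?thesis using r e l0 by auto
    qed
    obtain v0 where v0: "v0 \<in> W l" using l by auto
    \<comment> \<open>The element 0 lies in every field, so \<open>key\<close> applied to it yields
      the divisibility alone.\<close>
    have "0 ^ (q ^ j) = (0::'a)" for j using q_ge_2 by (simp add: power_0_left)
    hence la: "l dvd a" using key[of 0] by simp
    have "W l \<subseteq> (+) v0 ` {w. w ^ (q ^ (a div l)) = w}"
    proof
      fix v assume v: "v \<in> W l"
      have "(v - v0) ^ (q ^ a) = v - v0" using v v0 R_fixed by (simp add: W_def diff_power)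
      moreover have "((y + v) - (y + v0)) ^ (q ^ s) = (y + v) - (y + v0)"
        using v v0 unfolding diff_power by (simp add: W_def ds)
      hence "(v - v0) ^ (q ^ s) = v - v0" by simp
      ultimately have "(v - v0) ^ (q ^ (a div l)) = v - v0" using key by blast
      thus "v \<in> (+) v0 ` {w. w ^ (q ^ (a div l)) = w}" by (intro image_eqI[of _ _ "v - v0"]) auto
    qed
    hence "card (W l) \<le> card ((+) v0 ` {w. w ^ (q ^ (a div l)) = w})" by (intro card_mono) auto
    also have "\<dots> \<le> card {w::'a. w ^ (q ^ (a div l)) = w}" by (intro card_image_le) auto
    also have "\<dots> \<le> q ^ (a div l)" using la a0 l0 by (intro card_fixed_le) (auto simp: div_greater_zero_iff dvd_imp_le)
    finally show ?thesis using la by simp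
  qed
  \<comment> \<open>Distinct primes give distinct exponents \<open>a div l < a\<close>, so the sets
    \<open>W l\<close> together have fewer than \<open>q ^ a\<close> elements.\<close>
  have inj: "inj_on (\<lambda>l. a div l) Ls"
  proof (rule inj_onI)
    fix l l' assume l: "l \<in> Ls" "l' \<in> Ls" and eq: "a div l = a div l'"
    have "a = l * (a div l)" "a = l' * (a div l')" using l by (simp_all add: Ls_def)
    hence "a = l * (a div l)" "a = l' * (a div l)" unfolding eq .
    thus "l = l'" using a0 by (metis mult_right_cancel mult_0_right less_irrefl)
  qed
  have "card (\<Union>l\<in>Ls. W l) \<le> (\<Sum>l\<in>Ls. card (W l))" by (rule card_UN_le[OF finLs])
  also have "\<dots> \<le> (\<Sum>l\<in>Ls. q ^ (a div l))"
  proof (rule sum_mono)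
    fix l assume "l \<in> Ls"
    hence "prime l" "l dvd d" by (auto simp: Ls_def d_def)
    thus "card (W l) \<le> q ^ (a div l)" using W[of l] by (cases "W l = {}") auto
  qed
  also have "\<dots> = (\<Sum>e\<in>(\<lambda>l. a div l) ` Ls. q ^ e)" using inj by (simp add: sum.reindex)
  also have "\<dots> \<le> (\<Sum>e<a. q ^ e)"
    using a0 by (intro sum_mono2) (auto simp: Ls_def prime_gt_Suc_0_nat)
  also have "\<dots> < q ^ a" by (rule sum_powers_less)
  also have "\<dots> \<le> card R" unfolding R_def by (rule card_range_rel_trace[OF ab])
  finally have less: "card (\<Union>l\<in>Ls. W l) < card R" .
  have "\<not> R \<subseteq> (\<Union>l\<in>Ls. W l)"
  proof
    assume "R \<subseteq> (\<Union>l\<in>Ls. W l)"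
    hence "card R \<le> card (\<Union>l\<in>Ls. W l)" by (intro card_mono) auto
    thus False using less by simp
  qed
  then obtain v where v: "v \<in> R" "\<And>l. l \<in> Ls \<Longrightarrow> v \<notin> W l" by auto
  obtain e where e: "e > 0" "\<And>j. (y + v) ^ (q ^ j) = y + v \<longleftrightarrow> e dvd j" using period_exists by blast
  have "y ^ (q ^ d) = y" using c by (simp add: d_def)
  hence "e dvd d" using R_fixed_d[OF v(1)] e(2)[of d] by (simp add: add_power)
  \<comment> \<open>If \<open>e\<close> were a proper divisor of \<open>d\<close>, then
    \<open>y + v\<close> would lie in the subfield of degree \<open>d div l\<close> for some prime
    \<open>l\<close>; by \<open>W\<close> this prime divides \<open>a\<close>, against the choice of
    \<open>v\<close>.\<close>
  have "e = d"
  proof (rule ccontr)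
    assume ne: "e \<noteq> d"
    obtain r where r: "d = e * r" using \<open>e dvd d\<close> by auto
    hence "r \<noteq> 1" using ne by auto
    then obtain l where l: "prime l" "l dvd r" using prime_factor_nat by blast
    then obtain r' where "r = l * r'" by auto
    hence "d = l * (e * r')" using r by simp
    hence "e dvd d div l" "l dvd d" using l prime_gt_0_nat[of l] by auto
    hence "v \<in> W l" using e(2)[of "d div l"] v(1) by (simp add: W_def)
    hence "l \<in> Ls" using W[of l] l \<open>l dvd d\<close> by (auto simp: Ls_def)
    thus False using v \<open>v \<in> W l\<close> by blast
  qed
  obtain v' where "v = rel_trace a b v'" using v by (auto simp: R_def)
  thus thesis using that[of v'] e(2) a c \<open>e = d\<close> by (auto simp: d_def dest: dvd_trans[OF dvd_lcm1] dvd_trans[OF dvd_lcm2])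
qed

section \<open>Averaging polynomials over the Galois group\<close>

lemma Fq_power [simp]: "(c::'a) \<in> Fq q \<Longrightarrow> c ^ (q ^ j) = c"
  by (induction j) (simp_all add: Fq_def power_mult)

lemma polyfun_frob:
  assumes "h \<in> polyfun (Fq q :: 'a set) V"
  shows "h (\<lambda>i. x i ^ (q ^ j)) = h x ^ (q ^ j)"
  using assms by (induction rule: polyfun.induct) (simp_all add: add_power power_mult_distrib)

lemma sum_conjugates_in_Fq: "(\<Sum>j<m. (c::'a) ^ (q ^ j)) \<in> Fq q"
  using rel_trace_fixed[of 1 m c] by (simp add: rel_trace_def Fq_def)

text \<open>Averaging a polynomial over the Galois group replaces each coefficient by its trace.\<close>

lemma galois_average:
  assumes "g \<in> polyfun (UNIV :: 'a set) V"
  shows "(\<lambda>x. \<Sum>j<m. g (\<lambda>i. x i ^ (q ^ (m - j))) ^ (q ^ j)) \<in> polyfun (Fq q) V"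
proof -
  have "q > 0" using q_ge_2 by simp
  from polyfun_UNIV_subset_polyspan[OF assms this] show ?thesis
  proof (induction rule: polyspan.induct)
    case (scale h c)
    \<comment> \<open>The exponents \<open>m - j\<close> inside and \<open>j\<close> outside combine
      to \<open>m\<close>, so \<open>h\<close> contributes the same factor to every summand.\<close>
    have "(\<Sum>j<m. (c * h (\<lambda>i. x i ^ (q ^ (m - j)))) ^ (q ^ j)) = (\<Sum>j<m. c ^ (q ^ j)) * h x" for x
      unfolding sum_distrib_right polyfun_frob[OF scale]
      by (intro sum.cong) (simp_all add: power_mult_distrib power_power)
    thus ?case using polyfun.mult[OF polyfun.const[OF sum_conjugates_in_Fq[of c]] scale] by simp
  next
    case (add f g)
    show ?case using polyfun.add[OF add.IH] by (simp add: add_power sum.distrib)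
  qed
qed

text \<open>This is the Galois average of \<open>v\<close> times the indicator of \<open>u\<close>
  on the coordinates in \<open>V\<close>. Conjugates of \<open>u\<close> that agree on
  \<open>V\<close> contribute jointly, so a short period turns the value at \<open>u\<close> into a
  relative trace of \<open>v\<close>.\<close>

lemma equivariant_bump:
  fixes u :: "nat \<Rightarrow> 'a" and v :: 'a
  assumes "finite V"
  obtains f where "f \<in> polyfun (Fq q) V"
    "\<And>x. f x = (\<Sum>j<m. if \<forall>i\<in>V. x i = u i ^ (q ^ j) then v ^ (q ^ j) else 0)"
proof -
  \<comment> \<open>The factor 1 - z^(q^m - 1) is 1 for \<open>z = 0\<close> and 0 otherwise.
    Differences are written as sums with negatives to fit \<open>polyfun\<close>.\<close>
  define g where "g x = v * (\<Prod>i\<in>V. 1 + - ((x i + - u i) ^ (q ^ m - 1)))" for x :: "nat \<Rightarrow> 'a"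
  have gp: "g \<in> polyfun UNIV V"
    unfolding g_def [abs_def]
    by (intro polyfun.mult polyfun.add polyfun.const polyfun_prod polyfun_uminus polyfun_power polyfun.var assms) auto
  have Q1: "q ^ m - 1 > 0" using one_less_power[of q m] q_ge_2 m1 by simp
  have g: "g x = (if \<forall>i\<in>V. x i = u i then v else 0)" for x
  proof (cases "\<forall>i\<in>V. x i = u i")
    case True
    thus ?thesis using Q1 by (simp add: g_def power_0_left)
  next
    case False
    then obtain i where "i \<in> V" "x i \<noteq> u i" by auto
    hence "\<exists>i\<in>V. 1 + - ((x i + - u i) ^ (q ^ m - 1)) = 0"
      using power_card_minus_1[of "x i + - u i"] by (intro bexI[of _ i]) auto
    hence "(\<Prod>i\<in>V. 1 + - ((x i + - u i) ^ (q ^ m - 1))) = 0" using assms by (intro prod_zero) auto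
    thus ?thesis unfolding if_not_P[OF False] g_def by simp
  qed
  \<comment> \<open>The power \<open>q ^ (m - j)\<close> inverts the power \<open>q ^ j\<close>, so
    conjugating \<open>x\<close> can be traded for conjugating \<open>u\<close>.\<close>
  have eq: "x ^ (q ^ (m - j)) = w \<longleftrightarrow> x = w ^ (q ^ j)" if "j < m" for x w :: 'a and j
  proof -
    have "x ^ (q ^ (m - j)) = w \<longleftrightarrow> (x ^ (q ^ (m - j))) ^ (q ^ j) = w ^ (q ^ j)" by (simp only: power_inj)
    also have "(x ^ (q ^ (m - j))) ^ (q ^ j) = x" using that by (simp add: power_power)
    finally show ?thesis .
  qed
  have "(\<Sum>j<m. g (\<lambda>i. x i ^ (q ^ (m - j))) ^ (q ^ j)) =
      (\<Sum>j<m. if \<forall>i\<in>V. x i = u i ^ (q ^ j) then v ^ (q ^ j) else 0)" for x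
    unfolding g using q_ge_2 by (intro sum.cong) (auto simp: eq power_0_left)
  thus thesis using that[OF galois_average[OF gp]] by simp
qed

text \<open>The translation found by \<open>primitive_translate\<close> is the value at
  \<open>x i = u\<close> of a polynomial over F_q: the bump at \<open>u\<close> sums
  \<open>v ^ (q ^ j)\<close> over the multiples \<open>j < m\<close> of the period of
  \<open>u\<close>, which is the relative trace.\<close>

lemma primitive_polynomial_translate:
  fixes u y :: 'a
  obtains f where "f \<in> polyfun (Fq q) {i}"
    "\<And>x j. x i = u \<Longrightarrow> (y + f x) ^ (q ^ j) = y + f x \<Longrightarrow> u ^ (q ^ j) = u \<and> y ^ (q ^ j) = y"
proof -
  obtain a where a: "a > 0" "\<And>j. u ^ (q ^ j) = u \<longleftrightarrow> a dvd j" using period_exists by blast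
  have "a dvd m" using a(2)[of m] by simp
  then obtain b where ab: "m = a * b" by auto
  obtain v where v: "\<And>j. (y + rel_trace a b v) ^ (q ^ j) = y + rel_trace a b v \<Longrightarrow>
      u ^ (q ^ j) = u \<and> y ^ (q ^ j) = y"
    using primitive_translate[OF ab a(2), of y] by blast
  obtain f where f: "f \<in> polyfun (Fq q) {i}"
    "\<And>x. f x = (\<Sum>j<m. if \<forall>i'\<in>{i}. x i' = u ^ (q ^ j) then v ^ (q ^ j) else 0)"
    using equivariant_bump[of "{i}" "\<lambda>_. u" v] by blast
  have "f x = rel_trace a b v" if "x i = u" for x
  proof -
    have "f x = (\<Sum>j<m. if a dvd j then v ^ (q ^ j) else 0)"
      unfolding f(2) using that a(2) by (intro sum.cong) (auto simp: eq_commute)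
    also have "\<dots> = (\<Sum>j\<in>{j. j < m \<and> a dvd j}. v ^ (q ^ j))"
      by (simp add: sum.If_cases Int_def lessThan_def)
    also have "{j. j < m \<and> a dvd j} = (\<lambda>i. a * i) ` {..<b}"
      using a(1) by (auto simp: ab elim!: dvdE)
    also have "(\<Sum>j\<in>(\<lambda>i. a * i) ` {..<b}. v ^ (q ^ j)) = rel_trace a b v"
      using a(1) by (subst sum.reindex) (auto simp: inj_on_def rel_trace_def)
    finally show ?thesis .
  qed
  thus thesis using that[OF f(1)] v by simp
qed

end

section \<open>Orbits and shears\<close>

lemma frob_funpow: "(frob q ^^ j) x = (\<lambda>i. x i ^ (q ^ j))"
  by (induction j) (simp_all add: frob_def power_mult[symmetric] mult.commute)

lemma frob_points: "x \<in> points n \<Longrightarrow> q > 0 \<Longrightarrow> (frob q ^^ j) x \<in> points n"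
  by (simp add: points_def frob_funpow power_0_left)

lemma finite_points: "finite (points n :: (nat \<Rightarrow> 'a::{finite,zero}) set)"
proof -
  have "points n \<subseteq> {x::nat \<Rightarrow> 'a. \<forall>i. (i \<in> {..<n} \<longrightarrow> x i \<in> UNIV) \<and> (i \<notin> {..<n} \<longrightarrow> x i = 0)}"
    by (auto simp: points_def)
  thus ?thesis by (rule finite_subset) (intro finite_set_of_finite_funs; simp)
qed

text \<open>Coordinates from \<open>n\<close> on are reset to 0, as in the affine and triangular
  maps.\<close>

definition shear :: "nat \<Rightarrow> nat \<Rightarrow> ((nat \<Rightarrow> 'a) \<Rightarrow> 'a) \<Rightarrow> (nat \<Rightarrow> 'a::field) \<Rightarrow> nat \<Rightarrow> 'a" where
  "shear n i f x = (\<lambda>j. if j < n then (if j = i then x i + f x else x j) else 0)"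

lemma shear_points: "shear n i f x \<in> points n"
  by (simp add: shear_def points_def)

lemma shear_eq: "x \<in> points n \<Longrightarrow> i < n \<Longrightarrow> shear n i f x = x(i := x i + f x)"
  by (auto simp: shear_def points_def fun_eq_iff)

lemma polyfun_rename:
  assumes "f \<in> polyfun C V"
  shows "(\<lambda>x. f (\<lambda>j. x (\<pi> j))) \<in> polyfun C (\<pi> ` V)"
  using assms by (induction rule: polyfun.induct) (auto intro: polyfun.intros)

text \<open>Conjugating by the transposition of the coordinates \<open>0\<close> and \<open>i\<close> makes the shear triangular.\<close>

lemma shear_tame:
  fixes f :: "(nat \<Rightarrow> 'a::field) \<Rightarrow> 'a"
  assumes i: "i < n" and f: "f \<in> polyfun (Fq q) ({..<n} - {i})" and "q > 0"
  shows "shear n i f \<in> tame_maps n q"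
proof -
  define \<tau> where "\<tau> = transpose 0 i"
  have \<tau>: "\<tau> (\<tau> j) = j" "\<tau> j < n \<longleftrightarrow> j < n" "\<tau> j = 0 \<longleftrightarrow> j = i" for j
    using i by (auto simp: \<tau>_def transpose_def)
  define sw where "sw = (\<lambda>(x :: nat \<Rightarrow> 'a) j. if j < n then x (\<tau> j) else 0)"
  \<comment> \<open>The permutation matrix of the transposition, which is its own inverse.\<close>
  define A where "A r c = (if c = \<tau> r then 1 else 0 :: 'a)" for r c
  have F01: "(0::'a) \<in> Fq q" "(1::'a) \<in> Fq q" using \<open>q > 0\<close> by (auto simp: Fq_def power_0_left)
  have "sw \<in> affine_maps n q"
    unfolding affine_maps_def
  proof (intro CollectI exI[of _ A] exI[of _ "\<lambda>_. 0"] conjI allI impI)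
    have delta: "(\<Sum>j<n. A r j * w j) = w (\<tau> r)" if "r < n" for r and w :: "nat \<Rightarrow> 'a"
      using that \<tau> by (simp add: A_def if_distrib[of "\<lambda>t. t * _"] sum.delta cong: if_cong)
    show "sw = (\<lambda>x i. if i < n then (\<Sum>j<n. A i j * x j) + 0 else 0)"
      by (auto simp: sw_def delta fun_eq_iff)
    show "(\<Sum>j<n. A r j * A j c) = (if r = c then 1 else 0)" if "r < n" for r c
      using that delta[OF that, of "\<lambda>j. A j c"] \<tau> by (auto simp: A_def)
    show "(\<Sum>j<n. A r j * A j c) = (if r = c then 1 else 0)" if "r < n" for r c
      using that delta[OF that, of "\<lambda>j. A j c"] \<tau> by (auto simp: A_def)
  qed (auto simp: A_def F01)
  hence sw_tame: "sw \<in> tame_maps n q" by (rule tame_maps.affine)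
  define f' where "f' = (\<lambda>x. f (\<lambda>j. x (\<tau> j)))"
  have "\<tau> ` ({..<n} - {i}) \<subseteq> {j. 0 < j \<and> j < n}"
    using \<tau> by (metis (no_types, lifting) DiffE image_subsetI insertI1 lessThan_iff mem_Collect_eq neq0_conv)
  hence f': "f' \<in> polyfun (Fq q) {j. 0 < j \<and> j < n}"
    unfolding f'_def by (rule polyfun_mono[OF polyfun_rename[OF f]])
  \<comment> \<open>In a triangular map the polynomial at index 0 may involve all other
    variables.\<close>
  define T where "T = (\<lambda>(x :: nat \<Rightarrow> 'a) j. if j < n then 1 * x j + (if j = 0 then f' else (\<lambda>_. 0)) x else 0)"
  have "T \<in> triangular_maps n q"
    unfolding triangular_maps_def
    by (intro CollectI exI[of _ "\<lambda>_. 1"] exI[of _ "\<lambda>j. if j = 0 then f' else (\<lambda>_. 0)"])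
       (auto simp: T_def F01 f' intro: polyfun.const)
  hence "T \<in> tame_maps n q" by (rule tame_maps.triangular)
  hence "sw \<circ> (T \<circ> sw) \<in> tame_maps n q" using sw_tame by (intro tame_maps.comp)
  moreover have "sw \<circ> (T \<circ> sw) = shear n i f"
  proof (intro ext)
    fix x j
    have "f (\<lambda>j. sw x (\<tau> j)) = f x"
      by (rule polyfun_cong[OF f]) (use \<tau> in \<open>auto simp: sw_def\<close>)
    thus "(sw \<circ> (T \<circ> sw)) x j = shear n i f x j"
      using \<tau> by (auto simp: sw_def T_def f'_def shear_def)
  qed
  ultimately show ?thesis by simp
qed

section \<open>Shears acting on Galois orbits\<close>

locale tame_action = finite_field_ext q m p k ty
  for q m p k :: nat and ty :: "'a::{finite,field} itself" +
  fixes n :: nat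
  assumes n3: "n \<ge> 3"
begin

abbreviation orb :: "(nat \<Rightarrow> 'a) \<Rightarrow> (nat \<Rightarrow> 'a) set" where
  "orb \<equiv> orbit q m"

text \<open>Every tame map lies in this set. Building the three properties into the definition
  saves checking them for arbitrary affine and triangular maps, since only shears are needed.\<close>

definition equivariant_tame :: "((nat \<Rightarrow> 'a) \<Rightarrow> (nat \<Rightarrow> 'a)) set" where
  "equivariant_tame = {F \<in> tame_maps n q. F ` points n \<subseteq> points n \<and> inj_on F (points n) \<and>
     (\<forall>x\<in>points n. \<forall>j. F ((frob q ^^ j) x) = (frob q ^^ j) (F x))}"

text \<open>The theorem follows once all even permutations are found in this subset of
  \<open>Ggroup n q m\<close>, whose elements are readily seen to permute the orbits.\<close>

definition G0 :: "((nat \<Rightarrow> 'a) set \<Rightarrow> (nat \<Rightarrow> 'a) set) set" where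
  "G0 = induced_perm n q m ` equivariant_tame"

lemma q_pos: "q > 0"
  using q_ge_2 by simp

text \<open>The Frobenius power \<open>m\<close> is the identity, so any exponent reduces modulo
  \<open>m\<close> to the range used in \<open>orbit\<close>.\<close>

lemma frob_in_orb: "(frob q ^^ j) x \<in> orb x"
proof -
  have "x i ^ (q ^ j) = x i ^ (q ^ (j mod m))" for i
  proof -
    obtain a where a: "a > 0" "\<And>j. x i ^ (q ^ j) = x i \<longleftrightarrow> a dvd j" using period_exists by blast
    have "x i ^ (q ^ (m * (j div m) + j mod m)) = x i ^ (q ^ (j mod m))"
      unfolding power_power[symmetric] using a(2)[of m] a(2)[of "m * (j div m)"] by simp
    thus ?thesis by simp
  qed
  thus ?thesis using m1 unfolding orbit_def by (intro CollectI exI[of _ "j mod m"]) (simp add: frob_funpow)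
qed

lemma self_in_orb: "x \<in> orb x"
  using frob_in_orb[of 0 x] by simp

lemma orbE:
  assumes "y \<in> orb x"
  obtains j where "j < m" "y = (frob q ^^ j) x"
  using assms by (auto simp: orbit_def)

lemma frob_frob: "(frob q ^^ i) ((frob q ^^ j) x) = (frob q ^^ (i + j)) x"
  by (simp add: funpow_add)

lemma frob_m [simp]: "(frob q ^^ m) (x :: nat \<Rightarrow> 'a) = x"
  by (simp add: frob_funpow)

lemma orb_eqI:
  assumes "y \<in> orb x"
  shows "orb y = orb x"
proof -
  have sub: "orb y \<subseteq> orb x" if "y \<in> orb x" for x y
    using that by (auto elim!: orbE simp: frob_frob intro: frob_in_orb)
  obtain j where j: "j < m" "y = (frob q ^^ j) x" using assms by (rule orbE)
  hence "x = (frob q ^^ (m - j)) y" by (simp add: frob_frob)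
  hence "x \<in> orb y" using frob_in_orb by metis
  thus ?thesis using sub assms by blast
qed

lemma orb_subset_points: "x \<in> points n \<Longrightarrow> orb x \<subseteq> points n"
  using frob_points q_pos by (auto elim!: orbE)

text \<open>Full size means that the \<open>m\<close> listed points are distinct. If those at
  \<open>i < j\<close> coincide, applying the power \<open>m - j\<close> gives the return time
  \<open>m - j + i\<close>, strictly between 0 and \<open>m\<close>.\<close>

lemma Xset_iff: "(x :: nat \<Rightarrow> 'a) \<in> Xset n q m \<longleftrightarrow>
    x \<in> points n \<and> (\<forall>j. 0 < j \<longrightarrow> j < m \<longrightarrow> (frob q ^^ j) x \<noteq> x)"
proof -
  have orb: "orb x = (\<lambda>j. (frob q ^^ j) x) ` {..<m}" by (auto simp: orbit_def)
  have "card (orb x) = m \<longleftrightarrow> inj_on (\<lambda>j. (frob q ^^ j) x) {..<m}"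
    unfolding orb using eq_card_imp_inj_on[of "{..<m}" "\<lambda>j. (frob q ^^ j) x"]
      card_image[of "\<lambda>j. (frob q ^^ j) x" "{..<m}"] by auto
  also have "\<dots> \<longleftrightarrow> (\<forall>j. 0 < j \<longrightarrow> j < m \<longrightarrow> (frob q ^^ j) x \<noteq> x)"
  proof (intro iffI allI impI notI)
    fix j assume j: "inj_on (\<lambda>j. (frob q ^^ j) x) {..<m}" "0 < j" "j < m" "(frob q ^^ j) x = x"
    have "j = 0" by (rule inj_onD[OF j(1)]) (use j in auto)
    thus False using j(2) by simp
  next
    assume *: "\<forall>j. 0 < j \<longrightarrow> j < m \<longrightarrow> (frob q ^^ j) x \<noteq> x"
    show "inj_on (\<lambda>j. (frob q ^^ j) x) {..<m}"
    proof (rule linorder_inj_onI)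
      fix i j assume ij: "i < j" "i \<in> {..<m}" "j \<in> {..<m}"
      show "(frob q ^^ i) x \<noteq> (frob q ^^ j) x"
      proof
        assume "(frob q ^^ i) x = (frob q ^^ j) x"
        hence "(frob q ^^ (m - j)) ((frob q ^^ i) x) = (frob q ^^ (m - j)) ((frob q ^^ j) x)" by simp
        hence fixd: "(frob q ^^ (m - j + i)) x = x" using ij by (simp add: frob_frob)
        have "0 < m - j + i" "m - j + i < m" using ij by auto
        from *[rule_format, OF this] fixd show False by contradiction
      qed
    qed auto
  qed
  finally show ?thesis by (simp add: Xset_def)
qed

lemma finite_Xbar: "finite (Xbar n q m :: (nat \<Rightarrow> 'a) set set)"
proof -
  have "Xset n q m \<subseteq> (points n :: (nat \<Rightarrow> 'a) set)" by (auto simp: Xset_def)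
  thus ?thesis unfolding Xbar_def using finite_points finite_subset by blast
qed

lemma equivariant_image_orb:
  assumes "F \<in> equivariant_tame" "x \<in> points n"
  shows "F ` orb x = orb (F x)"
proof
  show "F ` orb x \<subseteq> orb (F x)"
    using assms frob_in_orb by (auto simp: equivariant_tame_def elim!: orbE)
  show "orb (F x) \<subseteq> F ` orb x"
  proof
    fix y assume "y \<in> orb (F x)"
    then obtain j where "y = (frob q ^^ j) (F x)" by (rule orbE)
    hence "y = F ((frob q ^^ j) x)" using assms by (simp add: equivariant_tame_def)
    thus "y \<in> F ` orb x" using frob_in_orb by blast
  qed
qed

lemma equivariant_Xset:
  assumes "F \<in> equivariant_tame" "x \<in> Xset n q m"
  shows "F x \<in> Xset n q m"
proof -
  have x: "x \<in> points n" "card (orb x) = m" using assms by (auto simp: Xset_def)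
  have "inj_on F (orb x)"
    using assms(1) orb_subset_points[OF x(1)] by (auto simp: equivariant_tame_def intro: inj_on_subset)
  hence "card (orb (F x)) = m"
    using x(2) card_image unfolding equivariant_image_orb[OF assms(1) x(1), symmetric] by metis
  thus ?thesis using assms(1) x by (auto simp: Xset_def equivariant_tame_def)
qed

lemma induced_perm_orb:
  assumes "F \<in> equivariant_tame" "x \<in> Xset n q m"
  shows "induced_perm n q m F (orb x) = orb (F x)"
  using assms equivariant_image_orb[of F x] by (auto simp: induced_perm_def Xbar_def Xset_def)

text \<open>Injectivity on points passes to orbits as sets, and finiteness supplies
  surjectivity.\<close>

lemma induced_perm_permutes:
  assumes F: "F \<in> equivariant_tame"
  shows "induced_perm n q m F permutes Xbar n q m"
proof (rule bij_imp_permutes)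
  have sub: "O1 \<subseteq> points n" if "O1 \<in> Xbar n q m" for O1 :: "(nat \<Rightarrow> 'a) set"
  proof -
    from that obtain x where "x \<in> points n" "O1 = orb x" by (auto simp: Xbar_def Xset_def)
    thus ?thesis using orb_subset_points by simp
  qed
  have "inj_on (induced_perm n q m F) (Xbar n q m)"
  proof (rule inj_onI)
    fix O1 O2 assume O: "O1 \<in> Xbar n q m" "O2 \<in> Xbar n q m"
      "induced_perm n q m F O1 = induced_perm n q m F O2"
    hence "F ` O1 = F ` O2" by (simp add: induced_perm_def)
    thus "O1 = O2"
      using F sub[OF O(1)] sub[OF O(2)] by (auto simp: equivariant_tame_def inj_on_image_eq_iff)
  qed
  moreover have "induced_perm n q m F ` Xbar n q m \<subseteq> Xbar n q m"
  proof
    fix O2 assume "O2 \<in> induced_perm n q m F ` Xbar n q m"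
    then obtain x where "x \<in> Xset n q m" "O2 = induced_perm n q m F (orb x)" by (auto simp: Xbar_def)
    thus "O2 \<in> Xbar n q m"
      using induced_perm_orb[OF F] equivariant_Xset[OF F] by (auto simp: Xbar_def)
  qed
  ultimately show "bij_betw (induced_perm n q m F) (Xbar n q m) (Xbar n q m)"
    using endo_inj_surj[OF finite_Xbar] by (auto simp: bij_betw_def)
qed (simp add: induced_perm_def)

lemma shear_equivariant:
  assumes "i < n" "f \<in> polyfun (Fq q) ({..<n} - {i})"
  shows "shear n i f \<in> equivariant_tame"
  unfolding equivariant_tame_def
proof (intro CollectI conjI ballI allI)
  show "shear n i f \<in> tame_maps n q" using assms q_pos by (intro shear_tame)
  show "inj_on (shear n i f) (points n)"
  proof (rule inj_onI)
    fix x y assume xy: "x \<in> points n" "y \<in> points n" "shear n i f x = shear n i f y"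
    hence eq: "(x(i := x i + f x)) j = (y(i := y i + f y)) j" for j by (simp add: shear_eq assms)
    \<comment> \<open>The polynomial \<open>f\<close> does not involve coordinate \<open>i\<close>,
      so its value can be read off the image.\<close>
    have "f x = f y" using eq by (intro polyfun_cong[OF assms(2)]) (metis DiffD2 fun_upd_apply singletonI)
    thus "x = y" using eq by (metis add_right_cancel ext fun_upd_apply)
  qed
  fix x :: "nat \<Rightarrow> 'a" and j
  show "shear n i f ((frob q ^^ j) x) = (frob q ^^ j) (shear n i f x)"
    using polyfun_frob[OF assms(2), of x j] q_pos
    by (auto simp: shear_def frob_funpow fun_eq_iff add_power power_0_left)
qed (auto simp: shear_points)

lemma equivariant_comp:
  assumes "F \<in> equivariant_tame" "F' \<in> equivariant_tame"
  shows "F \<circ> F' \<in> equivariant_tame"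
proof -
  have 1: "F ` points n \<subseteq> points n" "F' ` points n \<subseteq> points n" "inj_on F (points n)" "inj_on F' (points n)"
    "F \<in> tame_maps n q" "F' \<in> tame_maps n q"
    using assms unfolding equivariant_tame_def by blast+
  have "inj_on (F \<circ> F') (points n)" using 1 by (intro comp_inj_on) (auto intro: inj_on_subset)
  thus ?thesis using 1 assms tame_maps.comp[OF 1(5,6)] unfolding equivariant_tame_def by (auto simp: image_subset_iff)
qed

sublocale finite_perm_group "Xbar n q m :: (nat \<Rightarrow> 'a) set set" G0
proof
  show "finite (Xbar n q m :: (nat \<Rightarrow> 'a) set set)" by (rule finite_Xbar)
  show "h permutes Xbar n q m" if "h \<in> G0" for h
    using that induced_perm_permutes by (auto simp: G0_def)
  show "id \<in> G0"
  proof -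
    have zero: "(\<lambda>_. 0) \<in> polyfun (Fq q :: 'a set) ({..<n} - {0})"
      using q_pos by (intro polyfun.const) (simp add: Fq_def)
    hence sh: "shear n 0 (\<lambda>_. 0) \<in> equivariant_tame" using n3 by (intro shear_equivariant) auto
    have "induced_perm n q m (shear n 0 (\<lambda>_. 0)) Ob = Ob" for Ob :: "(nat \<Rightarrow> 'a) set"
    proof (cases "Ob \<in> Xbar n q m")
      case True
      then obtain x where x: "x \<in> Xset n q m" "Ob = orb x" by (auto simp: Xbar_def)
      hence "shear n 0 (\<lambda>_. 0) x = x" using n3 by (simp add: Xset_def shear_eq)
      thus ?thesis using induced_perm_orb[OF sh x(1)] x by simp
    qed (simp add: induced_perm_def)
    thus ?thesis unfolding G0_def using sh by (intro image_eqI[of _ _ "shear n 0 (\<lambda>_. 0)"]) (auto simp: fun_eq_iff)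
  qed
  show "g \<circ> h \<in> G0" if gh: "g \<in> G0" "h \<in> G0" for g h
  proof -
    obtain F F' where F: "F \<in> equivariant_tame" "g = induced_perm n q m F"
      and F': "F' \<in> equivariant_tame" "h = induced_perm n q m F'" using gh by (auto simp: G0_def)
    have "g \<circ> h = induced_perm n q m (F \<circ> F')"
    proof
      fix Ob :: "(nat \<Rightarrow> 'a) set"
      show "(g \<circ> h) Ob = induced_perm n q m (F \<circ> F') Ob"
      proof (cases "Ob \<in> Xbar n q m")
        case True
        hence "h Ob \<in> Xbar n q m"
          using induced_perm_permutes[OF F'(1)] by (simp add: F' permutes_in_image)
        thus ?thesis using True by (simp add: F F' induced_perm_def image_comp)
      qed (simp add: F F' induced_perm_def)
    qed
    thus ?thesis using equivariant_comp[OF F(1) F'(1)] by (auto simp: G0_def)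
  qed
qed

lemma G0_subset: "G0 \<subseteq> Ggroup n q m"
  by (auto simp: G0_def Ggroup_def equivariant_tame_def)

section \<open>Linking orbits with a generating coordinate\<close>

text \<open>Such a \<open>g\<close> generates F_{q^m} over F_q.\<close>

definition gen :: "'a \<Rightarrow> bool" where
  "gen g \<longleftrightarrow> (\<forall>j. 0 < j \<longrightarrow> j < m \<longrightarrow> g ^ (q ^ j) \<noteq> g)"

lemma genD: "gen g \<Longrightarrow> g ^ (q ^ j) = g \<Longrightarrow> j < m \<Longrightarrow> j = 0"
  by (auto simp: gen_def)

lemma gen_Xset:
  assumes "x \<in> points n" "gen (x l)"
  shows "x \<in> Xset n q m"
  using assms by (auto simp: Xset_iff frob_funpow gen_def fun_eq_iff)

text \<open>The shear by the bump at \<open>P\<close> adds exactly \<open>v\<close>, because the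
  generating coordinate \<open>l\<close> separates the conjugates of \<open>P\<close>. Off the
  conjugates of the line through \<open>P\<close> in direction \<open>i\<close> the bump
  vanishes.\<close>

lemma bump_shear_exists:
  assumes P: "P \<in> points n" "gen (P l)" and il: "i < n" "l < n" "i \<noteq> l" and v: "v \<noteq> 0"
  obtains h where "h \<in> G0" "h (orb P) = orb (P(i := P i + v))" "h (orb P) \<noteq> orb P"
    "\<And>Ob. h Ob \<noteq> Ob \<Longrightarrow> \<exists>y\<in>points n. Ob = orb y \<and> (\<forall>j<n. j \<noteq> i \<longrightarrow> y j = P j)"
proof -
  obtain f where f: "f \<in> polyfun (Fq q) ({..<n} - {i})"
    "\<And>x. f x = (\<Sum>j<m. if \<forall>i'\<in>{..<n} - {i}. x i' = P i' ^ (q ^ j) then v ^ (q ^ j) else 0)"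
    using equivariant_bump[of "{..<n} - {i}" P v] by blast
  have sh: "shear n i f \<in> equivariant_tame" using shear_equivariant il f by blast
  have PX: "P \<in> Xset n q m" using gen_Xset P by blast
  have "f P = (\<Sum>j<m. if j = 0 then v else 0)"
    unfolding f(2)
  proof (intro sum.cong refl)
    fix j assume j: "j \<in> {..<m}"
    show "(if \<forall>i'\<in>{..<n} - {i}. P i' = P i' ^ (q ^ j) then v ^ (q ^ j) else 0) = (if j = 0 then v else 0)"
      using genD[OF P(2), of j] j il by (cases "j = 0") auto
  qed
  also have "\<dots> = v" using m1 by (simp add: sum.delta)
  finally have "shear n i f P = P(i := P i + v)" using P il by (simp add: shear_eq)
  hence hP: "induced_perm n q m (shear n i f) (orb P) = orb (P(i := P i + v))"
    using induced_perm_orb[OF sh PX] by simp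
  have ne: "orb (P(i := P i + v)) \<noteq> orb P"
  proof
    assume "orb (P(i := P i + v)) = orb P"
    hence "P(i := P i + v) \<in> orb P" using self_in_orb by blast
    then obtain j where j: "j < m" "P(i := P i + v) = (frob q ^^ j) P" by (rule orbE)
    hence "P l = P l ^ (q ^ j)" using il by (metis frob_funpow fun_upd_other)
    hence "j = 0" using genD[OF P(2) _ j(1)] by metis
    hence "P(i := P i + v) = P" using j by simp
    hence "P i + v = P i" by (metis fun_upd_same)
    thus False using v by simp
  qed
  have supp: "\<exists>y\<in>points n. Ob = orb y \<and> (\<forall>j<n. j \<noteq> i \<longrightarrow> y j = P j)"
    if Ob: "induced_perm n q m (shear n i f) Ob \<noteq> Ob" for Ob
  proof -
    have "Ob \<in> Xbar n q m" using Ob by (metis induced_perm_def)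
    then obtain x where x: "x \<in> Xset n q m" "Ob = orb x" by (auto simp: Xbar_def)
    hence xp: "x \<in> points n" by (simp add: Xset_def)
    have "f x \<noteq> 0"
    proof
      assume "f x = 0"
      hence "shear n i f x = x" using xp il by (simp add: shear_eq)
      thus False using Ob induced_perm_orb[OF sh x(1)] x by simp
    qed
    then obtain j where j: "j < m" "\<forall>i'\<in>{..<n} - {i}. x i' = P i' ^ (q ^ j)"
      unfolding f(2) by (elim sum.not_neutral_contains_not_neutral) (auto split: if_splits)
    \<comment> \<open>This conjugate of \<open>x\<close> lies on the line through \<open>P\<close>
      itself.\<close>
    define y where "y = (frob q ^^ (m - j)) x"
    have "y i' = P i'" if "i' < n" "i' \<noteq> i" for i'
      using j that by (simp add: y_def frob_funpow power_power)
    moreover have "y \<in> points n" unfolding y_def using frob_points[OF xp q_pos] .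
    moreover have "orb y = orb x" unfolding y_def by (intro orb_eqI frob_in_orb)
    ultimately show ?thesis using x by auto
  qed
  show thesis
    using that[of "induced_perm n q m (shear n i f)"] sh hP ne supp by (auto simp: G0_def)
qed

text \<open>Bump shears in the directions \<open>i\<close> and \<open>j\<close> both move the orbit
  of \<open>P\<close>. An orbit moved by both has a point on each line; these points share the
  generating coordinate \<open>P l\<close>, so they coincide, and the lines meet only in
  \<open>P\<close>.\<close>

lemma linked_line:
  assumes P: "P \<in> points n" "gen (P l)" and ijl: "i < n" "j < n" "l < n" "i \<noteq> l" "j \<noteq> l" "i \<noteq> j"
  shows "linked (orb P) (orb (P(i := P i + v)))"
proof (cases "v = 0")
  case True
  thus ?thesis by (simp add: linked_refl)
next
  case False
  obtain s where s: "s \<in> G0" "s (orb P) = orb (P(i := P i + v))" "s (orb P) \<noteq> orb P"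
    "\<And>Ob. s Ob \<noteq> Ob \<Longrightarrow> \<exists>y\<in>points n. Ob = orb y \<and> (\<forall>j<n. j \<noteq> i \<longrightarrow> y j = P j)"
    using bump_shear_exists[OF P ijl(1,3,4) False] by blast
  obtain t where t: "t \<in> G0" "t (orb P) \<noteq> orb P"
    "\<And>Ob. t Ob \<noteq> Ob \<Longrightarrow> \<exists>y\<in>points n. Ob = orb y \<and> (\<forall>j'<n. j' \<noteq> j \<longrightarrow> y j' = P j')"
    using bump_shear_exists[OF P ijl(2,3,5), of 1] by (metis zero_neq_one)
  have common: "Ob = orb P" if Ob: "s Ob \<noteq> Ob" "t Ob \<noteq> Ob" for Ob
  proof -
    obtain y where y: "y \<in> points n" "Ob = orb y" "\<forall>j<n. j \<noteq> i \<longrightarrow> y j = P j" using s(4)[OF Ob(1)] by blast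
    obtain z where z: "z \<in> points n" "Ob = orb z" "\<forall>j'<n. j' \<noteq> j \<longrightarrow> z j' = P j'" using t(3)[OF Ob(2)] by blast
    have "z \<in> orb y" using self_in_orb y z by metis
    then obtain r where r: "r < m" "z = (frob q ^^ r) y" by (rule orbE)
    moreover have "y l = P l" "z l = P l" using y(3) z(3) ijl by auto
    ultimately have "P l ^ (q ^ r) = P l" by (metis frob_funpow)
    hence "r = 0" using genD P r(1) by blast
    hence "z = y" using r by simp
    have "y a = P a" for a
    proof (cases "a < n")
      case True
      thus ?thesis using y(3) z(3) \<open>z = y\<close> ijl by (cases "a = i") auto
    qed (use y P in \<open>simp add: points_def\<close>)
    hence "y = P" by (rule ext)
    thus ?thesis using y by simp
  qed
  have "cyc3 (orb P) (s (orb P)) (t (orb P)) \<in> G0" "s (orb P) \<noteq> t (orb P)"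
    using commutator_cyc3[OF s(1) t(1) s(3) t(2)] common by blast+
  thus ?thesis unfolding linked_def using s t by metis
qed

text \<open>The coordinates other than \<open>l\<close> are changed from those of \<open>x\<close>
  to those of \<open>y\<close> one at a time, each by a move along a line.\<close>

lemma linked_common_coord:
  assumes xy: "x \<in> points n" "y \<in> points n" "x l = y l" "gen (x l)" "l < n"
  shows "linked (orb x) (orb y)"
proof -
  have "linked (orb x) (orb (\<lambda>i. if i \<in> A then y i else x i))" if "finite A" "A \<subseteq> {..<n} - {l}" for A
    using that
  proof (induction A rule: finite_induct)
    case empty
    thus ?case by (simp add: linked_refl)
  next
    case (insert i A)
    define P where "P = (\<lambda>i. if i \<in> A then y i else x i)"
    have i: "i < n" "i \<noteq> l" using insert by auto
    \<comment> \<open>The second direction required by \<open>linked_line\<close> exists because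
      \<open>n \<ge> 3\<close>.\<close>
    have "\<exists>j<n. j \<noteq> i \<and> j \<noteq> l"
    proof -
      have "card {i, l} \<le> 2" by (simp add: card_insert_if)
      hence "\<not> {..<3} \<subseteq> {i, l}" using card_mono[of "{i, l}" "{..<3::nat}"] by auto
      then obtain j where "j < 3" "j \<notin> {i, l}" by auto
      thus ?thesis using n3 by (intro exI[of _ j]) auto
    qed
    then obtain j where j: "j < n" "j \<noteq> i" "j \<noteq> l" by blast
    have "P \<in> points n" using xy by (auto simp: P_def points_def)
    moreover have "gen (P l)" using xy by (simp add: P_def)
    ultimately have "linked (orb P) (orb (P(i := P i + (y i - x i))))"
      using i j xy by (intro linked_line[of P l i j]) auto
    moreover have "P(i := P i + (y i - x i)) = (\<lambda>i'. if i' \<in> insert i A then y i' else x i')"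
      using insert(2) by (auto simp: P_def fun_eq_iff)
    moreover have "linked (orb x) (orb P)" unfolding P_def using insert by auto
    ultimately show ?case using linked_trans by metis
  qed
  from this[of "{..<n} - {l}"] have "linked (orb x) (orb (\<lambda>i. if i \<in> {..<n} - {l} then y i else x i))" by simp
  moreover have "(\<lambda>i. if i \<in> {..<n} - {l} then y i else x i) = y"
    using xy by (auto simp: fun_eq_iff points_def)
  ultimately show ?thesis by simp
qed

text \<open>With all coordinates equal, a generating one survives any change of a single
  coordinate.\<close>

definition diag :: "'a \<Rightarrow> nat \<Rightarrow> 'a" where
  "diag g = (\<lambda>i. if i < n then g else 0)"

lemma diag_points: "diag g \<in> points n"
  by (simp add: diag_def points_def)

lemma diag_apply [simp]: "i < n \<Longrightarrow> diag g i = g"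
  by (simp add: diag_def)

lemma linked_diag:
  assumes "x \<in> points n" "l < n" "gen (x l)"
  shows "linked (orb x) (orb (diag (x l)))"
  using assms diag_points by (intro linked_common_coord[of _ _ l]) auto

text \<open>In the chain \<open>x\<close>, \<open>diag g\<close>, \<open>w\<close>,
  \<open>diag h\<close>, \<open>y\<close> any two neighbours share a generating coordinate;
  \<open>w\<close> has \<open>g\<close> at index 0 and \<open>h\<close> at index 1.\<close>

lemma linked_gen:
  assumes "x \<in> points n" "l < n" "gen (x l)" "y \<in> points n" "l' < n" "gen (y l')"
  shows "linked (orb x) (orb y)"
proof -
  define g h where "g = x l" and "h = y l'"
  have n: "0 < n" "1 < n" using n3 by auto
  define w where "w = (diag g)(1 := h)"
  have w: "w \<in> points n" using n diag_points[of g] by (auto simp: w_def points_def)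
  have "linked (orb (diag g)) (orb w)"
    using assms w n diag_points by (intro linked_common_coord[of _ _ 0]) (auto simp: w_def g_def)
  moreover have "linked (orb w) (orb (diag h))"
    using assms w n diag_points by (intro linked_common_coord[of _ _ 1]) (auto simp: w_def h_def)
  moreover have "linked (orb x) (orb (diag g))" "linked (orb (diag h)) (orb y)"
    using linked_diag assms linked_sym unfolding g_def h_def by blast+
  ultimately show ?thesis using linked_trans by blast
qed

section \<open>Reaching every orbit of full period\<close>

text \<open>Any two good orbits are linked, by \<open>linked_gen\<close> and transitivity, so it
  remains to show that every orbit in \<open>Xbar n q m\<close> is good.\<close>

definition good :: "(nat \<Rightarrow> 'a) set \<Rightarrow> bool" where
  "good Ob \<longleftrightarrow> (\<exists>y\<in>points n. \<exists>l<n. gen (y l) \<and> linked Ob (orb y))"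

text \<open>A diagonal point \<open>z\<close> with generating entries keeps such an entry under the
  shear, so the images of \<open>x\<close> and \<open>z\<close> are linked. Group elements reflect
  links, hence \<open>x\<close> and \<open>z\<close> are linked too.\<close>

lemma good_shear:
  assumes x: "x \<in> Xset n q m" and f: "i < n" "f \<in> polyfun (Fq q) ({..<n} - {i})"
    and good: "good (orb (shear n i f x))"
  shows "good (orb x)"
proof -
  obtain y l where y: "y \<in> points n" "l < n" "gen (y l)" "linked (orb (shear n i f x)) (orb y)"
    using good by (auto simp: good_def)
  define z where "z = diag (y l)"
  have z: "z \<in> points n" "gen (z l)" using y diag_points by (auto simp: z_def)
  hence zX: "z \<in> Xset n q m" using gen_Xset by blast
  obtain l' where l': "l' < n" "l' \<noteq> i" using n3 by (metis One_nat_def less_le_trans one_less_numeral_iff semiring_norm(77) zero_less_numeral zero_neq_one)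
  have "gen (shear n i f z l')" using l' y by (simp add: shear_def z_def)
  hence "linked (orb y) (orb (shear n i f z))"
    using linked_gen[OF y(1,2,3)] l' shear_points by blast
  hence 1: "linked (orb (shear n i f x)) (orb (shear n i f z))" using y(4) linked_trans by blast
  have sh: "shear n i f \<in> equivariant_tame" using shear_equivariant f by blast
  have "linked (induced_perm n q m (shear n i f) (orb x)) (induced_perm n q m (shear n i f) (orb z))"
    using 1 by (simp add: induced_perm_orb[OF sh] x zX)
  hence "linked (orb x) (orb z)" using sh by (subst (asm) linked_image_iff) (auto simp: G0_def)
  thus ?thesis unfolding good_def using z y(2) by blast
qed

lemma good_Xset:
  assumes "x \<in> Xset n q m"
  shows "good (orb x)"
proof -
  \<comment> \<open>The invariant says that the coordinates with indices from \<open>r\<close> to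
    \<open>n - 1\<close> together generate F_{q^m}. For \<open>r = n - 1\<close> the last coordinate
    does so alone.\<close>
  have "good (orb x)" if "r \<le> n - 1" "x \<in> points n"
    "\<And>j. j < m \<Longrightarrow> \<forall>i. r \<le> i \<and> i < n \<longrightarrow> x i ^ (q ^ j) = x i \<Longrightarrow> j = 0" for r x
    using that
  proof (induction r arbitrary: x rule: inc_induct)
    case base
    have "gen (x (n - 1))"
      unfolding gen_def
    proof (intro allI impI notI)
      fix j assume j: "0 < j" "j < m" "x (n - 1) ^ (q ^ j) = x (n - 1)"
      have "i = n - 1" if "n - 1 \<le> i \<and> i < n" for i using that by auto
      hence "\<forall>i. n - 1 \<le> i \<and> i < n \<longrightarrow> x i ^ (q ^ j) = x i" using j(3) by metis
      thus False using base(2)[OF j(2)] j(1) by simp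
    qed
    thus ?case unfolding good_def using base(1) n3 linked_refl by (intro bexI[of _ x] exI[of _ "n - 1"]) auto
  next
    case (step r)
    have r: "Suc r < n" using step by simp
    have xX: "x \<in> Xset n q m"
      unfolding Xset_iff
    proof (intro conjI allI impI notI)
      fix j assume "0 < j" "j < m" "(frob q ^^ j) x = x"
      thus False using step.prems(2)[of j] by (auto simp: frob_funpow fun_eq_iff)
    qed (rule step.prems)
    obtain f where f: "f \<in> polyfun (Fq q) {r}" and
      f': "\<And>z j. z r = x r \<Longrightarrow> (x (Suc r) + f z) ^ (q ^ j) = x (Suc r) + f z \<Longrightarrow>
        x r ^ (q ^ j) = x r \<and> x (Suc r) ^ (q ^ j) = x (Suc r)"
      using primitive_polynomial_translate[of r "x r" "x (Suc r)"] by metis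
    have fV: "f \<in> polyfun (Fq q) ({..<n} - {Suc r})" using f r by (rule_tac polyfun_mono) auto
    define x' where "x' = shear n (Suc r) f x"
    have x': "x' = x(Suc r := x (Suc r) + f x)"
      unfolding x'_def using step.prems r by (simp add: shear_eq)
    have "good (orb x')"
    proof (rule step.IH)
      show "x' \<in> points n" unfolding x'_def by (rule shear_points)
      fix j assume j: "j < m" "\<forall>i. Suc r \<le> i \<and> i < n \<longrightarrow> x' i ^ (q ^ j) = x' i"
      hence "(x (Suc r) + f x) ^ (q ^ j) = x (Suc r) + f x" using r by (auto simp: x')
      hence a: "x r ^ (q ^ j) = x r" "x (Suc r) ^ (q ^ j) = x (Suc r)" using f'[of x j] by auto
      have "x i ^ (q ^ j) = x i" if "r \<le> i" "i < n" for i
      proof -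
        consider "i = r" | "i = Suc r" | "i > Suc r" using \<open>r \<le> i\<close> by linarith
        thus ?thesis
        proof cases
          case 3
          thus ?thesis using j(2)[rule_format, of i] that by (simp add: x')
        qed (use a in auto)
      qed
      thus "j = 0" using step.prems(2)[OF j(1)] by blast
    qed
    thus ?case using good_shear[OF xX r fV] unfolding x'_def by blast
  qed
  \<comment> \<open>For \<open>r = 0\<close> the invariant is the full period of \<open>x\<close>,
    since coordinates from \<open>n\<close> on are 0.\<close>
  moreover have "j = 0" if "j < m" "\<forall>i. 0 \<le> i \<and> i < n \<longrightarrow> x i ^ (q ^ j) = x i" for j
  proof -
    have "x i ^ (q ^ j) = x i" for i
      using that(2) assms q_pos by (cases "i < n") (auto simp: Xset_def points_def power_0_left)
    hence "(frob q ^^ j) x = x" by (simp add: frob_funpow)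
    thus ?thesis using assms that(1) unfolding Xset_iff by auto
  qed
  ultimately show ?thesis using assms unfolding Xset_iff by blast
qed

lemma Alt_subset_Ggroup: "Alt (Xbar n q m :: (nat \<Rightarrow> 'a) set set) \<subseteq> Ggroup n q m"
proof -
  have "linked O1 O2" if "O1 \<in> Xbar n q m" "O2 \<in> Xbar n q m" for O1 O2
  proof -
    have "good O1" "good O2" using that good_Xset by (auto simp: Xbar_def)
    then obtain y1 l1 y2 l2 where y1: "y1 \<in> points n" "l1 < n" "gen (y1 l1)" "linked O1 (orb y1)"
      and y2: "y2 \<in> points n" "l2 < n" "gen (y2 l2)" "linked O2 (orb y2)"
      unfolding good_def by blast
    have "linked (orb y1) (orb y2)" using linked_gen y1 y2 by blast
    thus ?thesis using y1(4) linked_sym[OF y2(4)] linked_trans by blast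
  qed
  thus ?thesis using Alt_subset_if_linked G0_subset by blast
qed

end

theorem mainTheorem3:
  fixes n q m p k :: nat
  assumes "prime p" and "k \<ge> 1" and "q = p ^ k" and "m \<ge> 1"
    and "card (UNIV :: 'a::{finite,field} set) = q ^ m"
    and "n \<ge> 3"
  shows "Alt (Xbar n q m :: (nat \<Rightarrow> 'a) set set) \<subseteq> Ggroup n q m"
proof -
  interpret tame_action q m p k "TYPE('a)" n
    by unfold_locales (use assms in auto)
  show ?thesis by (rule Alt_subset_Ggroup)
qed

end
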